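(* Let $\{X_n\}_{n=-\infty}^{\infty}$ be a real-valued stationary time series with $E(|X_0|^2)<\infty$, and let $\zeta_k$ and $g_k$ be the stopping times and estimators built from $\{X_n\}$, the partitions $\{\mathcal{P}_k\}$ and the block lengths $\{l_k\}$ as described in the context. Then $$\lim_{k\to\infty}E\left(\left|g_k-E(X_{\zeta_k+1}\mid X_0^{\zeta_k})\right|^2\right)=0.$$
   Context: Notation: $X_m^n=(X_m,\dots,X_n)$ for $m\le n$. Partitions: $\{\mathcal{P}_k\}_{k=0}^\infty$ is a nested sequence (each $\mathcal{P}_{k+1}$ refines $\mathcal{P}_k$) of finite or countably infinite partitions of $\mathbb{R}$ by intervals. For $x\in\mathbb{R}$, $[x]^k$ denotes the unique interval of $\mathcal{P}_k$ containing $x$. For $C\subseteq\mathbb{R}$, $\mathrm{diam}(C)=\sup_{y,z\in C}|z-y|$. It is assumed that $\lim_{k\to\infty}\mathrm{diam}([x]^k)=0$ for all $x\in\mathbb{R}$. Write $[X_m^n]^k=([X_m]^k,\dots,[X_n]^k)$. Block lengths: $\{l_k\}_{k\ge1}$ is a nondecreasing sequence of positive integers with $1\le l_k\le k$ and $\lim_{k\to\infty}l_k=\infty$. Stopping times: $\zeta_0=0$ and, for $k\ge1$, $$\eta_k=\min\{t>0:\ [X_{\zeta_{k-1}-(l_k-1)+t}^{\zeta_{k-1}+t}]^k=[X_{\zeta_{k-1}-(l_k-1)}^{\zeta_{k-1}}]^k\},\qquad \zeta_k=\zeta_{k-1}+\eta_k,$$ where $t$ ranges over positive integers. (These are finite almost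 surely; their values on a null event are immaterial.) Estimator: for $k\ge1$, $g_k=\frac1k\sum_{j=0}^{k-1}X_{\zeta_j+1}$. Conditioning on $X_0^{\zeta_k}$ means conditioning on the stopped $\sigma$-algebra generated by the observations up to the stopping time $\zeta_k$; thus on $\{\zeta_k=n\}$, $E(X_{\zeta_k+1}\mid X_0^{\zeta_k})=E(X_{n+1}\mid X_0^n)$ (the event $\{\zeta_k=n\}$ is determined by $X_0^n$). *)

theory Defs
  imports "HOL-Probability.Probability"
begin

definition stationary :: "'a measure \<Rightarrow> (int \<Rightarrow> 'a \<Rightarrow> real) \<Rightarrow> bool" where
  "stationary M X \<longleftrightarrow>
     (\<forall>i. X i \<in> borel_measurable M) \<and>
     (\<forall>J s. finite J \<longrightarrow>
        distr M (Pi\<^sub>M J (\<lambda>_. borel)) (\<lambda>\<omega>. \<lambda>i\<in>J. X (i + s) \<omega>) =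
        distr M (Pi\<^sub>M J (\<lambda>_. borel)) (\<lambda>\<omega>. \<lambda>i\<in>J. X i \<omega>))"

(* The library's real-valued diameter is unspecified on unbounded sets, and the
   cells of a partition may be unbounded. *)
definition ediam :: "real set \<Rightarrow> ereal" where
  "ediam C = (SUP (y, z) \<in> C \<times> C. ereal \<bar>z - y\<bar>)"

definition cell :: "(nat \<Rightarrow> real set set) \<Rightarrow> nat \<Rightarrow> real \<Rightarrow> real set" where
  "cell P k x = (THE C. C \<in> P k \<and> x \<in> C)"

(* refines A Q R says that Q and R are partitions of A and that Q is the finer one;
   is_interval includes unbounded and one-point intervals. *)
definition interval_partitions :: "(nat \<Rightarrow> real set set) \<Rightarrow> bool" where
  "interval_partitions P \<longleftrightarrow>
     (\<forall>k. partition_on UNIV (P k) \<and> countable (P k) \<and> (\<forall>C\<in>P k. is_interval C)) \<and>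
     (\<forall>k. refines UNIV (P (Suc k)) (P k)) \<and>
     (\<forall>x. (\<lambda>k. ediam (cell P k x)) \<longlonglongrightarrow> 0)"

definition block_lengths :: "(nat \<Rightarrow> nat) \<Rightarrow> bool" where
  "block_lengths l \<longleftrightarrow>
     mono_on {1..} l \<and> (\<forall>k\<ge>1. 1 \<le> l k \<and> l k \<le> k) \<and> filterlim l at_top sequentially"

(* The quantized block ([X_m]^k, ..., [X_n]^k) as a list. *)
definition qblock ::
  "(nat \<Rightarrow> real set set) \<Rightarrow> (int \<Rightarrow> 'a \<Rightarrow> real) \<Rightarrow> nat \<Rightarrow> int \<Rightarrow> int \<Rightarrow> 'a \<Rightarrow> real set list" where
  "qblock P X k m n \<omega> = map (\<lambda>i. cell P k (X i \<omega>)) [m..n]"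

(* The waiting time eta_k when zeta_(k-1) = z. The infimum over enat is the minimum if
   some t qualifies and \<infinity> otherwise. *)
definition wait_time ::
  "(nat \<Rightarrow> real set set) \<Rightarrow> (nat \<Rightarrow> nat) \<Rightarrow> (int \<Rightarrow> 'a \<Rightarrow> real) \<Rightarrow> nat \<Rightarrow> nat \<Rightarrow> 'a \<Rightarrow> enat" where
  "wait_time P l X k z \<omega> =
     (INF t \<in> {t::nat. t > 0 \<and>
        qblock P X k (int z - (int (l k) - 1) + int t) (int z + int t) \<omega> =
        qblock P X k (int z - (int (l k) - 1)) (int z) \<omega>}. enat t)"

(* Extended values make zeta a stopping time everywhere, also on the null event where some
   waiting time is infinite; there the argument the_enat \<infinity> has no effect, as \<infinity> + t = \<infinity>. *)
primrec zeta ::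
  "(nat \<Rightarrow> real set set) \<Rightarrow> (nat \<Rightarrow> nat) \<Rightarrow> (int \<Rightarrow> 'a \<Rightarrow> real) \<Rightarrow> nat \<Rightarrow> 'a \<Rightarrow> enat" where
  "zeta P l X 0 \<omega> = 0"
| "zeta P l X (Suc k) \<omega> =
     zeta P l X k \<omega> + wait_time P l X (Suc k) (the_enat (zeta P l X k \<omega>)) \<omega>"

(* X_(zeta_k + 1); its value where zeta_k = \<infinity> is arbitrary. *)
definition next_obs ::
  "(nat \<Rightarrow> real set set) \<Rightarrow> (nat \<Rightarrow> nat) \<Rightarrow> (int \<Rightarrow> 'a \<Rightarrow> real) \<Rightarrow> nat \<Rightarrow> 'a \<Rightarrow> real" where
  "next_obs P l X k \<omega> = X (int (the_enat (zeta P l X k \<omega>)) + 1) \<omega>"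

definition estimator ::
  "(nat \<Rightarrow> real set set) \<Rightarrow> (nat \<Rightarrow> nat) \<Rightarrow> (int \<Rightarrow> 'a \<Rightarrow> real) \<Rightarrow> nat \<Rightarrow> 'a \<Rightarrow> real" where
  "estimator P l X k \<omega> = (1 / real k) * (\<Sum>j = 0..<k. next_obs P l X j \<omega>)"

(* The sigma-algebra of X_0, ..., X_n for t = enat n, and of X_0, X_1, ... for t = \<infinity>. *)
definition obs_filtration :: "'a measure \<Rightarrow> (int \<Rightarrow> 'a \<Rightarrow> real) \<Rightarrow> enat \<Rightarrow> 'a measure" where
  "obs_filtration M X t =
     sigma (space M)
       (\<Union>i\<in>{i::nat. enat i \<le> t}. {X (int i) -` B \<inter> space M | B. B \<in> sets borel})"

lemma filtration_obs_filtration: "filtration (space M) (obs_filtration M X)"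
proof
  show "space (obs_filtration M X t) = space M" for t
    unfolding obs_filtration_def by (rule space_measure_of) auto
  show "sets (obs_filtration M X s) \<subseteq> sets (obs_filtration M X t)" if "s \<le> t" for s t
    unfolding obs_filtration_def
    by (subst (1 2) sets_measure_of; (rule sigma_sets_mono')?)
       (use that in \<open>auto intro: order_trans\<close>)
qed

definition stopped_algebra ::
  "'a measure \<Rightarrow> (nat \<Rightarrow> real set set) \<Rightarrow> (nat \<Rightarrow> nat) \<Rightarrow> (int \<Rightarrow> 'a \<Rightarrow> real) \<Rightarrow> nat \<Rightarrow> 'a measure" where
  "stopped_algebra M P l X k =
     filtration.pre_sigma (space M) (obs_filtration M X) (zeta P l X k)"

end

theory Submission
  imports Defs
begin

text \<open>
  Write \<open>\<Phi> k\<close> (called \<open>view k\<close> below) for the series recentred at the stopping time \<open>\<zeta> k\<close>, so that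
  the observation to be predicted is its coordinate \<open>1\<close>. The theorem rests on three facts.

  The recentred series has the law of the original one (\<open>distr_view\<close>). The waiting time
  \<open>\<zeta> (k + 1) - \<zeta> k\<close> is the first return time of the trajectory to its current quantized block, so
  \<open>\<Phi> (k + 1)\<close> is obtained from \<open>\<Phi> k\<close> by the first-return map to the level sets of a function with
  countably many values. Such a map is defined almost everywhere (Poincare recurrence) and preserves
  every invariant probability measure (\<open>return_map_preserves\<close>).

  The quantized past freezes (\<open>block_code_view_stable\<close>). The block of level \<open>j + 1\<close> is the same in
  \<open>\<Phi> j\<close> and \<open>\<Phi> (j + 1)\<close> by the choice of \<open>\<zeta> (j + 1)\<close>, and it determines the blocks of all lower
  levels because the partitions are nested and the block lengths do not decrease. A function \<open>v\<close> of the
  block of level \<open>m\<close> therefore takes the same value at all \<open>\<Phi> j\<close> with \<open>j \<ge> m\<close>.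

  The regression \<open>f\<close> of coordinate \<open>1\<close> on the infinite past is a limit in mean square of such
  functions \<open>v\<close> (\<open>regression_approximation\<close>), as the cells shrink and the blocks grow. Put
  \<open>\<delta> = \<parallel>f - v\<parallel>\<^sup>2\<close>. What has been observed at the time \<open>\<zeta> k\<close> lies between the block of level \<open>m\<close> and
  the infinite past of \<open>\<Phi> k\<close>. Hence the conditional expectation of the next observation, \<open>forecast k\<close>
  below, is also the conditional expectation of \<open>f \<circ> \<Phi> k\<close>, and as conditioning is a contraction, it is
  within \<open>\<delta>\<close> of \<open>v \<circ> \<Phi> k\<close> (\<open>forecast_error_le\<close>). By invariance of the law \<open>\<delta>\<close> is the same for
  all \<open>k \<ge> m\<close>, and by freezing so is \<open>v \<circ> \<Phi> k = v \<circ> \<Phi> m\<close>: the forecasts settle down in mean square.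

  Finally the estimator is the average of the forecasts plus the average of the innovations, that is
  of the observations minus their forecasts. The innovations are orthogonal and bounded in mean square,
  so their average vanishes like \<open>1 / k\<close>; the average of the forecasts and the last forecast are both
  eventually close to \<open>v \<circ> \<Phi> m\<close>.
\<close>

section \<open>Square-integrable functions\<close>

definition L2 :: "'a measure \<Rightarrow> ('a \<Rightarrow> real) set" where
  "L2 M = {f \<in> borel_measurable M. integrable M (\<lambda>x. (f x)\<^sup>2)}"

lemma L2D: "f \<in> L2 M \<Longrightarrow> f \<in> borel_measurable M" "f \<in> L2 M \<Longrightarrow> integrable M (\<lambda>x. (f x)\<^sup>2)"
  by (auto simp: L2_def)

lemma L2_mult: assumes "f \<in> L2 M" "g \<in> L2 M" shows "integrable M (\<lambda>x. f x * g x)"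
proof (rule Bochner_Integration.integrable_bound)
  show "integrable M (\<lambda>x. (f x)\<^sup>2 + (g x)\<^sup>2)"
    using assms by (auto simp: L2_def)
  show "AE x in M. norm (f x * g x) \<le> norm ((f x)\<^sup>2 + (g x)\<^sup>2)"
  proof (rule AE_I2)
    fix x
    have "2 * (\<bar>f x\<bar> * \<bar>g x\<bar>) \<le> (f x)\<^sup>2 + (g x)\<^sup>2"
      using zero_le_power2[of "\<bar>f x\<bar> - \<bar>g x\<bar>"] by (simp add: power2_diff)
    moreover have "0 \<le> \<bar>f x\<bar> * \<bar>g x\<bar>" by simp
    ultimately have "\<bar>f x\<bar> * \<bar>g x\<bar> \<le> (f x)\<^sup>2 + (g x)\<^sup>2" by linarith
    then show "norm (f x * g x) \<le> norm ((f x)\<^sup>2 + (g x)\<^sup>2)"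
      by (simp add: abs_mult)
  qed
qed (use assms in \<open>auto simp: L2_def intro!: borel_measurable_times\<close>)

lemma L2_add: assumes "f \<in> L2 M" "g \<in> L2 M" shows "(\<lambda>x. f x + g x) \<in> L2 M"
proof -
  have "integrable M (\<lambda>x. (f x)\<^sup>2 + (g x)\<^sup>2 + 2 * (f x * g x))"
    using L2_mult[OF assms] assms by (auto simp: L2_def)
  then show ?thesis
    using assms by (auto simp: L2_def power2_sum mult.assoc)
qed

lemma L2_cmult: "f \<in> L2 M \<Longrightarrow> (\<lambda>x. c * f x) \<in> L2 M"
  by (auto simp: L2_def power_mult_distrib)

lemma L2_diff: assumes "f \<in> L2 M" "g \<in> L2 M" shows "(\<lambda>x. f x - g x) \<in> L2 M"
  using L2_add[OF assms(1) L2_cmult[OF assms(2), of "-1"]] by simp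

lemma L2_zero: "(\<lambda>x. 0) \<in> L2 M"
  by (auto simp: L2_def)

lemma L2_sum: "(\<And>i. i \<in> I \<Longrightarrow> f i \<in> L2 M) \<Longrightarrow> (\<lambda>x. \<Sum>i\<in>I. f i x) \<in> L2 M"
  by (induction I rule: infinite_finite_induct) (auto intro: L2_zero L2_add)

lemma (in finite_measure) L2_const: "(\<lambda>x. c) \<in> L2 M"
  by (auto simp: L2_def)

lemma L2_AE_cong:
  assumes "f \<in> L2 M" "g \<in> borel_measurable M" "AE x in M. g x = f x"
  shows "g \<in> L2 M"
proof -
  have "integrable M (\<lambda>x. (g x)\<^sup>2) \<longleftrightarrow> integrable M (\<lambda>x. (f x)\<^sup>2)"
    using assms by (intro integrable_cong_AE) (auto simp: L2_def)
  then show ?thesis using assms by (auto simp: L2_def)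
qed

lemma L2_bounded_by:
  assumes "g \<in> L2 M" "f \<in> borel_measurable M" "\<And>x. x \<in> space M \<Longrightarrow> \<bar>f x\<bar> \<le> \<bar>g x\<bar>"
  shows "f \<in> L2 M"
proof -
  have "integrable M (\<lambda>x. (f x)\<^sup>2)"
    using assms
    by (intro Bochner_Integration.integrable_bound[OF L2D(2)[OF assms(1)]])
      (auto simp: L2_def abs_le_square_iff intro!: AE_I2)
  then show ?thesis using assms by (simp add: L2_def)
qed

lemma L2_max:
  assumes f: "f \<in> L2 M" and g: "g \<in> L2 M"
  shows "(\<lambda>x. max (f x) (g x)) \<in> L2 M"
proof (rule L2_bounded_by[OF L2_add[of "\<lambda>x. \<bar>f x\<bar>" M "\<lambda>x. \<bar>g x\<bar>"]])
  show "(\<lambda>x. \<bar>f x\<bar>) \<in> L2 M" "(\<lambda>x. \<bar>g x\<bar>) \<in> L2 M" "(\<lambda>x. max (f x) (g x)) \<in> borel_measurable M"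
    using f g by (auto simp: L2_def)
qed auto

lemma (in finite_measure) L2_integrable: "f \<in> L2 M \<Longrightarrow> integrable M f"
  by (auto simp: L2_def intro: square_integrable_imp_integrable)

lemma integral_square_add_le:
  assumes "f \<in> L2 M" "g \<in> L2 M"
  shows "(\<integral>x. (f x + g x)\<^sup>2 \<partial>M) \<le> 2 * (\<integral>x. (f x)\<^sup>2 \<partial>M) + 2 * (\<integral>x. (g x)\<^sup>2 \<partial>M)"
proof -
  have "(\<integral>x. (f x + g x)\<^sup>2 \<partial>M) \<le> (\<integral>x. 2 * (f x)\<^sup>2 + 2 * (g x)\<^sup>2 \<partial>M)"
  proof (rule integral_mono)
    show "integrable M (\<lambda>x. (f x + g x)\<^sup>2)" by (rule L2D(2)[OF L2_add[OF assms]])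
    show "integrable M (\<lambda>x. 2 * (f x)\<^sup>2 + 2 * (g x)\<^sup>2)" using assms by (auto simp: L2_def)
    show "(f x + g x)\<^sup>2 \<le> 2 * (f x)\<^sup>2 + 2 * (g x)\<^sup>2" for x
      using zero_le_power2[of "f x - g x"] by (simp add: power2_sum power2_diff)
  qed
  then show ?thesis using assms by (simp add: L2_def)
qed

lemma integral_square_sum_orthogonal:
  fixes k :: nat
  assumes "\<And>j. j < k \<Longrightarrow> D j \<in> L2 M"
    and "\<And>i j. i < j \<Longrightarrow> j < k \<Longrightarrow> (\<integral>x. D i x * D j x \<partial>M) = 0"
  shows "(\<integral>x. (\<Sum>j<k. D j x)\<^sup>2 \<partial>M) = (\<Sum>j<k. \<integral>x. (D j x)\<^sup>2 \<partial>M)"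
  using assms
proof (induction k)
  case (Suc k)
  let ?S = "\<lambda>x. \<Sum>j<k. D j x"
  have S: "?S \<in> L2 M" and Dk: "D k \<in> L2 M"
    using Suc.prems(1) by (auto intro!: L2_sum)
  have "(\<integral>x. ?S x * D k x \<partial>M) = (\<Sum>i<k. \<integral>x. D i x * D k x \<partial>M)"
    using Suc.prems(1) by (simp add: sum_distrib_right L2_mult)
  also have "\<dots> = 0" using Suc.prems(2) by simp
  finally have cross: "(\<integral>x. ?S x * D k x \<partial>M) = 0" .
  have "(\<integral>x. (\<Sum>j<Suc k. D j x)\<^sup>2 \<partial>M) = (\<integral>x. (?S x)\<^sup>2 + (D k x)\<^sup>2 + 2 * (?S x * D k x) \<partial>M)"
    by (simp add: power2_sum mult.assoc)
  also have "\<dots> = (\<integral>x. (?S x)\<^sup>2 \<partial>M) + (\<integral>x. (D k x)\<^sup>2 \<partial>M) + 2 * (\<integral>x. ?S x * D k x \<partial>M)"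
    using L2D(2)[OF S] L2D(2)[OF Dk] L2_mult[OF S Dk] by simp
  also have "\<dots> = (\<Sum>j<Suc k. \<integral>x. (D j x)\<^sup>2 \<partial>M)"
    using Suc by (simp add: cross)
  finally show ?case .
qed simp

text \<open>Jensen's inequality for the square: conditioning is a contraction in mean square.\<close>
lemma (in finite_measure_subalgebra) real_cond_exp_L2:
  assumes "f \<in> L2 M"
  shows "real_cond_exp M F f \<in> L2 M"
    and "(\<integral>x. (real_cond_exp M F f x)\<^sup>2 \<partial>M) \<le> (\<integral>x. (f x)\<^sup>2 \<partial>M)"
proof -
  have f: "integrable M f" by (rule L2_integrable[OF assms])
  have jensen: "AE x in M. (real_cond_exp M F f x)\<^sup>2 \<le> real_cond_exp M F (\<lambda>x. (f x)\<^sup>2) x"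
    by (rule real_cond_exp_jensens_inequality(2)[where I=UNIV and q="\<lambda>x. x\<^sup>2"])
      (use f assms in \<open>auto simp: L2_def convex_power2\<close>)
  have int: "integrable M (real_cond_exp M F (\<lambda>x. (f x)\<^sup>2))"
    by (rule real_cond_exp_int(1)[OF L2D(2)[OF assms]])
  have sq: "integrable M (\<lambda>x. (real_cond_exp M F f x)\<^sup>2)"
    by (rule Bochner_Integration.integrable_bound[OF int]) (use jensen in auto)
  then show "real_cond_exp M F f \<in> L2 M" by (simp add: L2_def)
  have "(\<integral>x. (real_cond_exp M F f x)\<^sup>2 \<partial>M) \<le> (\<integral>x. real_cond_exp M F (\<lambda>x. (f x)\<^sup>2) x \<partial>M)"
    by (rule integral_mono_AE[OF sq int jensen])
  also have "\<dots> = (\<integral>x. (f x)\<^sup>2 \<partial>M)"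
    by (rule real_cond_exp_int(2)[OF L2D(2)[OF assms]])
  finally show "(\<integral>x. (real_cond_exp M F f x)\<^sup>2 \<partial>M) \<le> (\<integral>x. (f x)\<^sup>2 \<partial>M)" .
qed

section \<open>First-return maps\<close>

text \<open>On the points that never return, which will form a null set, the value is arbitrary.\<close>
definition return_time :: "('a \<Rightarrow> 'a) \<Rightarrow> ('a \<Rightarrow> 'b) \<Rightarrow> 'a \<Rightarrow> nat" where
  "return_time T b x = (LEAST t. 0 < t \<and> b ((T ^^ t) x) = b x)"

definition return_map :: "('a \<Rightarrow> 'a) \<Rightarrow> ('a \<Rightarrow> 'b) \<Rightarrow> 'a \<Rightarrow> 'a" where
  "return_map T b x = (T ^^ return_time T b x) x"

lemma return_time:
  assumes "\<exists>t>0. b ((T ^^ t) x) = b x"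
  shows "0 < return_time T b x" "b (return_map T b x) = b x"
  using LeastI_ex[of "\<lambda>t. 0 < t \<and> b ((T ^^ t) x) = b x"] assms
  unfolding return_time_def return_map_def by auto

lemma measurable_return_map:
  fixes b :: "'a \<Rightarrow> 'b :: countable"
  assumes [measurable]: "T \<in> N \<rightarrow>\<^sub>M N" "b \<in> N \<rightarrow>\<^sub>M count_space UNIV"
  shows "return_map T b \<in> N \<rightarrow>\<^sub>M N"
proof -
  note [measurable] = measurable_compose_n[OF assms(1)]
  have [measurable]: "return_time T b \<in> N \<rightarrow>\<^sub>M count_space UNIV"
    unfolding return_time_def by measurable
  show ?thesis
    unfolding return_map_def by (rule measurable_compose_countable) measurable
qed

text \<open>Let \<open>B n\<close> consist of the points that avoid the level set \<open>{b = d}\<close> at the times \<open>1, \<dots>, n - 1\<close> and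
  are in \<open>A\<close> at time \<open>n\<close>. A point starting in the level set and belonging to \<open>B n\<close> returns at time
  \<open>n\<close>, and its return is into \<open>A\<close>. A point of \<open>B n\<close> starting outside the level set can be moved back
  by one more step: the preimage of these points is \<open>B (n + 1)\<close>. So the returns at time \<open>n\<close> have
  measure \<open>\<mu> (B n) - \<mu> (B (n + 1))\<close>. The sum telescopes to \<open>\<mu> (B 1) = \<mu> A\<close>, because
  the sets \<open>B n\<close> with \<open>n \<ge> 1\<close> are disjoint, which forces \<open>\<mu> (B n)\<close> to tend to \<open>0\<close>.\<close>
lemma (in finite_measure) return_map_level_set:
  fixes b :: "'a \<Rightarrow> 'b :: countable"
  assumes T[measurable]: "T \<in> M \<rightarrow>\<^sub>M M" and inv: "distr M M T = M"
    and b[measurable]: "b \<in> M \<rightarrow>\<^sub>M count_space UNIV"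
    and A[measurable]: "A \<in> sets M" and Ad: "\<And>x. x \<in> A \<Longrightarrow> b x = d"
  shows "emeasure M {x \<in> space M. b x = d \<and> (\<exists>t>0. b ((T ^^ t) x) = b x) \<and> return_map T b x \<in> A}
    = emeasure M A"
proof -
  note [measurable] = measurable_compose_n[OF T]
  define B where "B n = {x \<in> space M. (\<forall>i\<in>{0<..<n}. b ((T ^^ i) x) \<noteq> d) \<and> (T ^^ n) x \<in> A}" for n
  define C where "C n = {x \<in> B n. b x = d}" for n
  have [measurable]: "B n \<in> sets M" for n
    unfolding B_def by measurable
  have [measurable]: "C n \<in> sets M" for n
  proof -
    have "C n = B n \<inter> {x\<in>space M. b x = d}" by (auto simp: C_def B_def)
    then show ?thesis by simp
  qed
  have "measure M (C (Suc n)) = measure M (B (Suc n)) - measure M (B (Suc (Suc n)))" for n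
  proof -
    have "T -` (B (Suc n) - C (Suc n)) \<inter> space M = B (Suc (Suc n))"
    proof -
      have split: "(\<forall>i\<in>{0<..<Suc (Suc n)}. Q i) \<longleftrightarrow> Q 1 \<and> (\<forall>i\<in>{0<..<Suc n}. Q (Suc i))" for Q
      proof safe
        fix i assume "Q 1" "\<forall>i\<in>{0<..<Suc n}. Q (Suc i)" "i \<in> {0<..<Suc (Suc n)}"
        then show "Q i" by (cases i; cases "i = 1") auto
      qed auto
      show ?thesis
        using measurable_space[OF T]
        unfolding B_def C_def split funpow_Suc_right by auto
    qed
    then have "measure M (B (Suc (Suc n))) = measure (distr M M T) (B (Suc n) - C (Suc n))"
      by (subst measure_distr) auto
    also have "\<dots> = measure M (B (Suc n)) - measure M (C (Suc n))"
      unfolding inv by (rule finite_measure_Diff) (auto simp: C_def)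
    finally show ?thesis by simp
  qed
  then have C_eq: "measure M (C (Suc n)) = - (measure M (B (Suc (Suc n))) - measure M (B (Suc n)))" for n
    by simp
  have disjB: "disjoint_family (\<lambda>n. B (Suc n))"
  proof -
    have "B (Suc m) \<inter> B (Suc n) = {}" if "m < n" for m n
    proof (rule Int_emptyI)
      fix x assume x: "x \<in> B (Suc m)" "x \<in> B (Suc n)"
      from x(1) have "b ((T ^^ Suc m) x) = d" using Ad unfolding B_def by blast
      moreover have "Suc m \<in> {0<..<Suc n}" using that by simp
      ultimately show False using x(2) unfolding B_def by blast
    qed
    then show ?thesis
      unfolding disjoint_family_on_def by (metis inf_commute linorder_neqE_nat)
  qed
  have "summable (\<lambda>n. measure M (B (Suc n)))"
    by (intro sums_summable[OF finite_measure_UNION[OF _ disjB]]) auto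
  then have "(\<lambda>n. measure M (B (Suc n))) \<longlonglongrightarrow> 0"
    by (rule summable_LIMSEQ_zero)
  then have "(\<lambda>n. - (measure M (B (Suc (Suc n))) - measure M (B (Suc n)))) sums (- (0 - measure M (B (Suc 0))))"
    by (intro sums_minus telescope_sums)
  then have sumC: "(\<lambda>n. measure M (C (Suc n))) sums measure M (B (Suc 0))"
    unfolding C_eq by simp
  have "disjoint_family (\<lambda>n. C (Suc n))"
    using disjB by (rule disjoint_family_subset) (auto simp: C_def)
  then have "(\<lambda>n. measure M (C (Suc n))) sums measure M (\<Union>n. C (Suc n))"
    by (intro finite_measure_UNION) auto
  with sumC have "measure M (\<Union>n. C (Suc n)) = measure M (B (Suc 0))"
    by (simp add: sums_iff)
  also have "B (Suc 0) = T -` A \<inter> space M"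
    by (auto simp: B_def)
  also have "measure M (T -` A \<inter> space M) = measure M A"
    by (subst (2) inv[symmetric], subst measure_distr) auto
  finally have "measure M (\<Union>n. C (Suc n)) = measure M A" .
  moreover have "(\<Union>n. C (Suc n)) =
    {x \<in> space M. b x = d \<and> (\<exists>t>0. b ((T ^^ t) x) = b x) \<and> return_map T b x \<in> A}"
  proof safe
    fix x n assume x: "x \<in> C (Suc n)"
    then show "x \<in> space M" "b x = d" by (auto simp: C_def B_def)
    have ret: "b ((T ^^ Suc n) x) = b x" using x Ad by (auto simp: C_def B_def)
    then show "\<exists>t>0. b ((T ^^ t) x) = b x" by blast
    have "return_time T b x = Suc n"
      unfolding return_time_def
    proof (rule Least_equality)
      show "Suc n \<le> t" if "0 < t \<and> b ((T ^^ t) x) = b x" for t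
        using that x by (force simp: C_def B_def not_less_eq_eq)
    qed (use ret in simp)
    then show "return_map T b x \<in> A"
      using x by (simp add: return_map_def C_def B_def)
  next
    fix x t assume x: "x \<in> space M" "return_map T b x \<in> A" "0 < t" "b ((T ^^ t) x) = b x" "d = b x"
    obtain n where n: "return_time T b x = Suc n"
      using return_time(1)[of b T x] x by (metis gr0_implies_Suc)
    have "b ((T ^^ i) x) \<noteq> b x" if "0 < i" "i < Suc n" for i
      using not_less_Least[of i "\<lambda>t. 0 < t \<and> b ((T ^^ t) x) = b x"] that n
      unfolding return_time_def by auto
    then have "x \<in> C (Suc n)"
      using x n unfolding C_def B_def return_map_def by (auto simp del: funpow.simps)
    then show "x \<in> (\<Union>n. C (Suc n))" by blast
  qed
  ultimately show ?thesis
    by (simp add: emeasure_eq_measure)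
qed

text \<open>Adding up the level sets, the points that return and do so into \<open>A\<close> have the measure of \<open>A\<close>. With the
  whole space for \<open>A\<close> this is Poincare recurrence, which in turn allows the points without a return to
  be neglected.\<close>
proposition (in prob_space) return_map_preserves:
  fixes b :: "'a \<Rightarrow> 'b :: countable"
  assumes T[measurable]: "T \<in> M \<rightarrow>\<^sub>M M" and inv: "distr M M T = M"
    and b[measurable]: "b \<in> M \<rightarrow>\<^sub>M count_space UNIV"
  shows "AE x in M. \<exists>t>0. b ((T ^^ t) x) = b x"
    and "distr M M (return_map T b) = M"
proof -
  note [measurable] = measurable_return_map[OF T b]
  let ?rec = "\<lambda>x. \<exists>t>0. b ((T ^^ t) x) = b x"
  have *: "emeasure M {x \<in> space M. ?rec x \<and> return_map T b x \<in> A} = emeasure M A"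
    if [measurable]: "A \<in> sets M" for A
  proof -
    let ?A = "\<lambda>d. {x \<in> A. b x = d}"
    let ?R = "\<lambda>d. {x \<in> space M. b x = d \<and> ?rec x \<and> return_map T b x \<in> ?A d}"
    have [measurable]: "?A d \<in> sets M" for d
    proof -
      have "?A d = A \<inter> {x\<in>space M. b x = d}" using sets.sets_into_space[OF that] by auto
      then show ?thesis by simp
    qed
    have "{x \<in> space M. ?rec x \<and> return_map T b x \<in> A} = (\<Union>d. ?R d)"
      using return_time(2)[of b T] by auto
    also have "emeasure M \<dots> = (\<integral>\<^sup>+d. emeasure M (?R d) \<partial>count_space UNIV)"
      by (rule emeasure_UN_countable) (auto simp: disjoint_family_on_def)
    also have "\<dots> = (\<integral>\<^sup>+d. emeasure M (?A d) \<partial>count_space UNIV)"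
      by (intro nn_integral_cong return_map_level_set[OF T inv b]) auto
    also have "\<dots> = emeasure M (\<Union>d. ?A d)"
      by (rule emeasure_UN_countable[symmetric]) (auto simp: disjoint_family_on_def)
    also have "(\<Union>d. ?A d) = A" by auto
    finally show ?thesis .
  qed
  have "{x \<in> space M. ?rec x \<and> return_map T b x \<in> space M} = {x \<in> space M. ?rec x}"
    using measurable_space[OF measurable_return_map[OF T b]] by auto
  with *[of "space M"] have "emeasure M {x \<in> space M. ?rec x} = 1"
    by (simp add: emeasure_space_1)
  then show rec: "AE x in M. ?rec x"
    by (intro AE_I_eq_1) auto
  show "distr M M (return_map T b) = M"
  proof (rule measure_eqI)
    fix A assume "A \<in> sets (distr M M (return_map T b))"
    then have [measurable]: "A \<in> sets M" by simp
    have "emeasure (distr M M (return_map T b)) A = emeasure M (return_map T b -` A \<inter> space M)"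
      by (rule emeasure_distr) auto
    also have "\<dots> = emeasure M {x \<in> space M. ?rec x \<and> return_map T b x \<in> A}"
      using rec by (intro emeasure_eq_AE) auto
    also have "\<dots> = emeasure M A" by (rule *) simp
    finally show "emeasure (distr M M (return_map T b)) A = emeasure M A" .
  qed simp
qed

section \<open>The law of a stationary series\<close>

abbreviation Seq :: "(int \<Rightarrow> real) measure" where
  "Seq \<equiv> Pi\<^sub>M UNIV (\<lambda>_. borel)"

definition time_shift :: "int \<Rightarrow> (int \<Rightarrow> real) \<Rightarrow> int \<Rightarrow> real" where
  "time_shift n x = (\<lambda>i. x (i + n))"

definition trajectory :: "(int \<Rightarrow> 'a \<Rightarrow> real) \<Rightarrow> int \<Rightarrow> 'a \<Rightarrow> int \<Rightarrow> real" where
  "trajectory X n \<omega> = (\<lambda>i. X (i + n) \<omega>)"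

lemma space_Seq: "space Seq = UNIV"
  by (simp add: space_PiM)

lemma time_shift_trajectory: "time_shift m (trajectory X n \<omega>) = trajectory X (n + m) \<omega>"
  by (simp add: time_shift_def trajectory_def add_ac)

lemma time_shift_funpow: "(time_shift 1 ^^ t) x = time_shift (int t) x"
  by (induction t) (simp_all add: time_shift_def fun_eq_iff add_ac)

lemma measurable_time_shift: "time_shift n \<in> Seq \<rightarrow>\<^sub>M Seq"
  unfolding time_shift_def by (rule measurable_PiM_single') (auto simp: space_Seq)

lemma measurable_trajectory:
  assumes "\<And>i. X i \<in> borel_measurable M"
  shows "trajectory X n \<in> M \<rightarrow>\<^sub>M Seq"
  unfolding trajectory_def by (rule measurable_PiM_single') (use assms in auto)

text \<open>Cylinder sets determine a finite measure on the sequence space, so invariance of the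
  finite-dimensional distributions is invariance of the whole law.\<close>
lemma stationary_distr_trajectory:
  assumes "prob_space M" and st: "stationary M X"
  shows "distr M Seq (trajectory X n) = distr M Seq (trajectory X 0)"
proof (rule measure_eqI_PiM_infinite[where I=UNIV and M="\<lambda>_. borel"])
  interpret prob_space M by fact
  have X[measurable]: "X i \<in> borel_measurable M" for i using st by (simp add: stationary_def)
  note [measurable] = measurable_trajectory[OF X]
  show "finite_measure (distr M Seq (trajectory X n))"
    by (intro finite_measure_distr) simp
  fix A :: "int \<Rightarrow> real set" and J
  assume J: "finite J" and A: "\<And>i. i \<in> J \<Longrightarrow> A i \<in> sets borel"
  have *: "distr M Seq (trajectory X s) (prod_emb UNIV (\<lambda>_. borel) J (Pi\<^sub>E J A)) =
     distr M (Pi\<^sub>M J (\<lambda>_. borel)) (\<lambda>\<omega>. \<lambda>i\<in>J. X (i + s) \<omega>) (Pi\<^sub>E J A)" for s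
  proof -
    have "distr M Seq (trajectory X s) (prod_emb UNIV (\<lambda>_. borel) J (Pi\<^sub>E J A))
        = emeasure M (trajectory X s -` prod_emb UNIV (\<lambda>_. borel) J (Pi\<^sub>E J A) \<inter> space M)"
      using J A by (intro emeasure_distr sets_PiM_I) auto
    also have "trajectory X s -` prod_emb UNIV (\<lambda>_. borel) J (Pi\<^sub>E J A) \<inter> space M
        = (\<lambda>\<omega>. \<lambda>i\<in>J. X (i + s) \<omega>) -` Pi\<^sub>E J A \<inter> space M"
      by (auto simp: prod_emb_def trajectory_def PiE_iff restrict_def extensional_def)
    also have "emeasure M \<dots> = distr M (Pi\<^sub>M J (\<lambda>_. borel)) (\<lambda>\<omega>. \<lambda>i\<in>J. X (i + s) \<omega>) (Pi\<^sub>E J A)"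
      using J A by (intro emeasure_distr[symmetric] sets_PiM_I_finite measurable_restrict) auto
    finally show ?thesis .
  qed
  have "distr M (Pi\<^sub>M J (\<lambda>_. borel)) (\<lambda>\<omega>. \<lambda>i\<in>J. X (i + n) \<omega>) =
     distr M (Pi\<^sub>M J (\<lambda>_. borel)) (\<lambda>\<omega>. \<lambda>i\<in>J. X (i + 0) \<omega>)"
    using st J by (simp add: stationary_def)
  then show "distr M Seq (trajectory X n) (prod_emb UNIV (\<lambda>_. borel) J (Pi\<^sub>E J A)) =
     distr M Seq (trajectory X 0) (prod_emb UNIV (\<lambda>_. borel) J (Pi\<^sub>E J A))"
    by (simp only: *)
qed simp_all

section \<open>Quantized blocks\<close>

text \<open>The cells are replaced by their numbers, which makes the values of the block countably many. The block
  is read backwards from time \<open>0\<close>.\<close>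
definition block_code :: "(nat \<Rightarrow> real set set) \<Rightarrow> (nat \<Rightarrow> nat) \<Rightarrow> nat \<Rightarrow> (int \<Rightarrow> real) \<Rightarrow> nat list" where
  "block_code P l k x = map (\<lambda>i. to_nat_on (P k) (cell P k (x (- int i)))) [0..<l k]"

lemma measurable_map_upt:
  fixes f :: "nat \<Rightarrow> 'b \<Rightarrow> nat"
  assumes "\<And>i. i < n \<Longrightarrow> f i \<in> N \<rightarrow>\<^sub>M count_space UNIV"
  shows "(\<lambda>x. map (\<lambda>i. f i x) [0..<n]) \<in> N \<rightarrow>\<^sub>M count_space UNIV"
  using assms
proof (induction n)
  case (Suc n)
  have "(\<lambda>x. (map (\<lambda>i. f i x) [0..<n], f n x)) \<in> N \<rightarrow>\<^sub>M count_space UNIV \<Otimes>\<^sub>M count_space UNIV"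
    using Suc by (intro measurable_Pair) auto
  also have "count_space UNIV \<Otimes>\<^sub>M count_space UNIV = (count_space UNIV :: (nat list \<times> nat) measure)"
    by (simp add: pair_measure_countable)
  finally have "(\<lambda>x. (map (\<lambda>i. f i x) [0..<n], f n x)) \<in> N \<rightarrow>\<^sub>M count_space UNIV" .
  then have "(\<lambda>x. (\<lambda>(a, b). a @ [b]) (map (\<lambda>i. f i x) [0..<n], f n x)) \<in> N \<rightarrow>\<^sub>M count_space UNIV"
    by (rule measurable_compose) simp
  then show ?case by simp
qed simp

locale quantization =
  fixes P :: "nat \<Rightarrow> real set set" and l :: "nat \<Rightarrow> nat"
  assumes P: "interval_partitions P" and l: "block_lengths l"
begin

lemma cell_eqI: assumes "C \<in> P k" "x \<in> C" shows "cell P k x = C"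
  unfolding cell_def
proof (rule the_equality)
  fix D assume "D \<in> P k \<and> x \<in> D"
  moreover have "partition_on UNIV (P k)" using P by (simp add: interval_partitions_def)
  ultimately show "D = C"
    using assms unfolding partition_on_def disjoint_def by blast
qed (use assms in simp)

lemma cell: "cell P k x \<in> P k" "x \<in> cell P k x"
proof -
  have "partition_on UNIV (P k)" using P by (simp add: interval_partitions_def)
  then obtain C where "C \<in> P k" "x \<in> C" unfolding partition_on_def by blast
  then show "cell P k x \<in> P k" "x \<in> cell P k x" using cell_eqI by auto
qed

lemma cell_eq_iff: "cell P k y = cell P k x \<longleftrightarrow> y \<in> cell P k x"
  using cell cell_eqI by metis

lemma cell_mono: assumes "m \<le> j" shows "cell P j x \<subseteq> cell P m x"
  using assms
proof (induction j rule: dec_induct)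
  case (step j)
  have "refines UNIV (P (Suc j)) (P j)" using P by (simp add: interval_partitions_def)
  then obtain D where D: "D \<in> P j" "cell P (Suc j) x \<subseteq> D"
    unfolding refines_def using cell(1) by blast
  then have "cell P j x = D" using cell(2) by (intro cell_eqI) auto
  with D step show ?case by blast
qed simp

lemma cell_eq_mono: "m \<le> j \<Longrightarrow> cell P j x = cell P j y \<Longrightarrow> cell P m x = cell P m y"
  using cell_mono[of m j x] cell(2)[of y j] cell_eq_iff[of m y x] by auto

lemma block_code_eq_iff:
  "block_code P l k x = block_code P l k y \<longleftrightarrow> (\<forall>i<l k. cell P k (x (- int i)) = cell P k (y (- int i)))"
proof -
  have "countable (P k)" using P by (simp add: interval_partitions_def)
  then have "to_nat_on (P k) (cell P k u) = to_nat_on (P k) (cell P k v) \<longleftrightarrow> cell P k u = cell P k v" for u v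
    using cell(1) by (intro to_nat_on_inj)
  then show ?thesis by (auto simp: block_code_def)
qed

text \<open>A block of a higher level is at least as long and at least as finely quantized, and so determines the
  blocks of the lower levels. Level \<open>0\<close> is excluded because nothing is known about its block length.\<close>
lemma block_code_eq_mono:
  assumes "1 \<le> m" "m \<le> j" "block_code P l j x = block_code P l j y"
  shows "block_code P l m x = block_code P l m y"
proof -
  have "l m \<le> l j"
    using l assms(1,2) unfolding block_lengths_def by (auto intro: mono_onD)
  then show ?thesis
    using assms(3) cell_eq_mono[OF assms(2)] unfolding block_code_eq_iff by (meson order_less_le_trans)
qed

lemma measurable_cell_index: "(\<lambda>u. to_nat_on (P k) (cell P k u)) \<in> borel \<rightarrow>\<^sub>M count_space UNIV"
proof -
  have "(\<lambda>u. to_nat_on (P k) (cell P k u)) -` {n} \<in> sets borel" for n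
  proof (cases "\<exists>u. to_nat_on (P k) (cell P k u) = n")
    case True
    then obtain v where v: "to_nat_on (P k) (cell P k v) = n" by blast
    have "countable (P k)" using P by (simp add: interval_partitions_def)
    then have "to_nat_on (P k) (cell P k u) = n \<longleftrightarrow> cell P k u = cell P k v" for u
      unfolding v[symmetric] using cell(1) by (intro to_nat_on_inj)
    then have "(\<lambda>u. to_nat_on (P k) (cell P k u)) -` {n} = cell P k v"
      by (auto simp: cell_eq_iff)
    moreover have "is_interval (cell P k v)"
      using P cell(1) by (auto simp: interval_partitions_def)
    ultimately show ?thesis by (simp add: real_interval_borel_measurable)
  next
    case False
    then have "(\<lambda>u. to_nat_on (P k) (cell P k u)) -` {n} = {}" by auto
    then show ?thesis by simp
  qed
  then show ?thesis by (simp add: measurable_count_space_eq2_countable)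
qed

lemma measurable_block_code_compose:
  assumes "\<And>i. i < l k \<Longrightarrow> (\<lambda>x. g x (- int i)) \<in> borel_measurable N"
  shows "(\<lambda>x. block_code P l k (g x)) \<in> N \<rightarrow>\<^sub>M count_space UNIV"
  unfolding block_code_def
  by (intro measurable_map_upt measurable_compose[OF assms measurable_cell_index])

lemma measurable_block_code: "block_code P l k \<in> Seq \<rightarrow>\<^sub>M count_space UNIV"
  by (rule measurable_block_code_compose) simp

text \<open>The two descriptions list the block in opposite orders of time, which does not matter for equality.\<close>
lemma qblock_eq_iff:
  assumes "1 \<le> k"
  shows "qblock P X k (z - (int (l k) - 1) + t) (z + t) \<omega> = qblock P X k (z - (int (l k) - 1)) z \<omega>
    \<longleftrightarrow> block_code P l k (trajectory X (z + t) \<omega>) = block_code P l k (trajectory X z \<omega>)" (is "?L \<longleftrightarrow> ?R")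
proof -
  let ?q = "\<lambda>z. map (\<lambda>i. cell P k (X i \<omega>)) [z - (int (l k) - 1)..z]"
  have len: "length (?q z) = l k" for z by simp
  have nth: "?q z ! i = cell P k (X (z - (int (l k) - 1) + int i) \<omega>)" if "i < l k" for i z
    using that by (simp add: nth_upto)
  have "?L \<longleftrightarrow> ?q (z + t) = ?q z"
    by (simp add: qblock_def algebra_simps)
  also have "\<dots> \<longleftrightarrow> (\<forall>i<l k. ?q (z + t) ! i = ?q z ! i)"
    unfolding list_eq_iff_nth_eq len by simp
  also have "\<dots> \<longleftrightarrow> (\<forall>i<l k. cell P k (X (z + t - (int (l k) - 1) + int i) \<omega>)
      = cell P k (X (z - (int (l k) - 1) + int i) \<omega>))"
    by (simp add: nth)
  also have "\<dots> \<longleftrightarrow> (\<forall>i<l k. cell P k (X (- int i + (z + t)) \<omega>) = cell P k (X (- int i + z) \<omega>))"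
  proof -
    have rev: "(\<forall>i<n. Q i) \<longleftrightarrow> (\<forall>i<n. Q (n - Suc i))" for n and Q :: "nat \<Rightarrow> bool"
    proof (intro iffI allI impI)
      fix i assume "\<forall>i<n. Q (n - Suc i)" "i < n"
      moreover have "n - Suc i < n" "n - Suc (n - Suc i) = i" using \<open>i < n\<close> by auto
      ultimately show "Q i" by metis
    qed simp
    have "u - (int (l k) - 1) + int (l k - Suc i) = - int i + u" if "i < l k" for i u
      using that by auto
    then show ?thesis
      by (subst rev) (simp add: algebra_simps)
  qed
  also have "\<dots> \<longleftrightarrow> ?R"
    unfolding block_code_eq_iff trajectory_def ..
  finally show ?thesis .
qed

lemma wait_time_eq:
  assumes "1 \<le> k"
  shows "wait_time P l X k z \<omega> = (INF t \<in> {t. 0 < t \<and>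
    block_code P l k (trajectory X (int z + int t) \<omega>) = block_code P l k (trajectory X (int z) \<omega>)}. enat t)"
  unfolding wait_time_def qblock_eq_iff[OF assms] ..

lemma wait_time_eq_enat_iff:
  assumes "1 \<le> k"
  shows "wait_time P l X k z \<omega> = enat t \<longleftrightarrow>
    0 < t \<and> block_code P l k (trajectory X (int z + int t) \<omega>) = block_code P l k (trajectory X (int z) \<omega>) \<and>
    (\<forall>s\<in>{0<..<t}. block_code P l k (trajectory X (int z + int s) \<omega>) \<noteq> block_code P l k (trajectory X (int z) \<omega>))"
    (is "_ = _ \<longleftrightarrow> ?R")
proof -
  define S where "S = {t. 0 < t \<and> block_code P l k (trajectory X (int z + int t) \<omega>) = block_code P l k (trajectory X (int z) \<omega>)}"
  have w: "wait_time P l X k z \<omega> = (INF t\<in>S. enat t)"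
    unfolding S_def by (rule wait_time_eq[OF assms])
  have "(INF t\<in>S. enat t) = enat t \<longleftrightarrow> t \<in> S \<and> (\<forall>s<t. s \<notin> S)"
  proof
    assume eq: "(INF t\<in>S. enat t) = enat t"
    then have "enat ` S \<noteq> {}" by (auto simp: top_enat_def)
    then have "(INF t\<in>S. enat t) \<in> enat ` S"
      unfolding Inf_enat_def by (auto intro: LeastI)
    then have "t \<in> S" using eq by auto
    moreover have "s \<notin> S" if "s < t" for s
      using INF_lower[of s S enat] eq that by auto
    ultimately show "t \<in> S \<and> (\<forall>s<t. s \<notin> S)" by simp
  next
    assume "t \<in> S \<and> (\<forall>s<t. s \<notin> S)"
    then show "(INF t\<in>S. enat t) = enat t"
      by (intro antisym INF_lower INF_greatest) (auto simp: not_less[symmetric])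
  qed
  then show ?thesis
    unfolding w by (auto simp: S_def)
qed

end

section \<open>Stopping times and the series seen from them\<close>

text \<open>A function built from one measurable function per value of the stopping time is known at the stopping
  time, since countably many values allow a decomposition along them.\<close>
lemma (in filtration) measurable_pre_sigma_countable:
  assumes T: "stopping_time F T" and ctbl: "countable (UNIV :: 't set)"
    and G: "\<And>t. G t \<in> F t \<rightarrow>\<^sub>M N"
  shows "(\<lambda>\<omega>. G (T \<omega>) \<omega>) \<in> pre_sigma T \<rightarrow>\<^sub>M N"
proof (rule measurableI)
  show "G (T \<omega>) \<omega> \<in> space N" if "\<omega> \<in> space (pre_sigma T)" for \<omega>
    using that measurable_space[OF G] by (simp add: space_pre_sigma space_F)
  fix B assume B: "B \<in> sets N"
  show "(\<lambda>\<omega>. G (T \<omega>) \<omega>) -` B \<inter> space (pre_sigma T) \<in> sets (pre_sigma T)"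
  proof (rule sets_pre_sigmaI[OF T])
    fix t
    have "{\<omega> \<in> (\<lambda>\<omega>. G (T \<omega>) \<omega>) -` B \<inter> space (pre_sigma T). T \<omega> \<le> t} =
      (\<Union>s\<in>{..t}. (G s -` B \<inter> space (F s)) \<inter> {\<omega> \<in> space (F s). T \<omega> = s})"
      by (auto simp: space_pre_sigma space_F)
    also have "\<dots> \<in> sets (F t)"
    proof (rule sets.countable_UN'')
      show "countable {..t}" using ctbl by (rule countable_subset[rotated]) simp
      fix s assume "s \<in> {..t}"
      moreover have "(G s -` B \<inter> space (F s)) \<inter> {\<omega> \<in> space (F s). T \<omega> = s} \<in> sets (F s)"
      proof (rule sets.Int)
        show "G s -` B \<inter> space (F s) \<in> sets (F s)" by (rule measurable_sets[OF G B])
        show "{\<omega> \<in> space (F s). T \<omega> = s} \<in> sets (F s)" by (rule predE[OF stopping_time_eq_const[OF T]])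
      qed
      ultimately show "(G s -` B \<inter> space (F s)) \<inter> {\<omega> \<in> space (F s). T \<omega> = s} \<in> sets (F t)"
        using sets_F_mono[of s t] by auto
    qed
    finally show "{\<omega> \<in> (\<lambda>\<omega>. G (T \<omega>) \<omega>) -` B \<inter> space (pre_sigma T). T \<omega> \<le> t} \<in> sets (F t)" .
  qed
qed

locale intermittent_scheme = quantization P l + prob_space M
  for M :: "'a measure" and X :: "int \<Rightarrow> 'a \<Rightarrow> real" and P l +
  assumes stationary: "stationary M X"
    and square_integrable: "integrable M (\<lambda>\<omega>. (X 0 \<omega>)\<^sup>2)"
begin

abbreviation F :: "enat \<Rightarrow> 'a measure" where "F \<equiv> obs_filtration M X"
abbreviation \<zeta> :: "nat \<Rightarrow> 'a \<Rightarrow> enat" where "\<zeta> \<equiv> zeta P l X"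
abbreviation FS :: "nat \<Rightarrow> 'a measure" where "FS \<equiv> stopped_algebra M P l X"

text \<open>The trajectory recentred at the \<open>k\<close>-th stopping time. On the null event \<open>\<zeta> k = \<infinity>\<close> it is centred at
  an arbitrary time.\<close>
definition view :: "nat \<Rightarrow> 'a \<Rightarrow> int \<Rightarrow> real" where
  "view k \<omega> = trajectory X (int (the_enat (\<zeta> k \<omega>))) \<omega>"

sublocale obs: filtration "space M" F
  by (rule filtration_obs_filtration)

lemma measurable_X[measurable]: "X i \<in> borel_measurable M"
  using stationary by (simp add: stationary_def)

lemma sets_F: "sets (F t) = sigma_sets (space M)
    (\<Union>i\<in>{i::nat. enat i \<le> t}. {X (int i) -` B \<inter> space M | B. B \<in> sets borel})"
  unfolding obs_filtration_def by (rule sets_measure_of) auto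

lemma measurable_X_F: "enat i \<le> t \<Longrightarrow> X (int i) \<in> borel_measurable (F t)"
  by (rule measurableI) (auto simp: obs.space_F sets_F intro!: sigma_sets.Basic)

lemma sets_F_subset: "sets (F t) \<subseteq> sets M"
  unfolding sets_F by (rule sets.sigma_sets_subset) auto

lemma zeta_Suc_eq_enat_iff:
  "\<zeta> (Suc k) \<omega> = enat n \<longleftrightarrow>
    (\<exists>m<n. \<zeta> k \<omega> = enat m \<and> wait_time P l X (Suc k) m \<omega> = enat (n - m))"
proof
  assume eq: "\<zeta> (Suc k) \<omega> = enat n"
  then obtain m w where mw: "\<zeta> k \<omega> = enat m" "wait_time P l X (Suc k) m \<omega> = enat w" "n = m + w"
    by (cases "\<zeta> k \<omega>"; cases "wait_time P l X (Suc k) (the_enat (\<zeta> k \<omega>)) \<omega>") auto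
  then have "0 < w" by (subst (asm) wait_time_eq_enat_iff) auto
  with mw show "\<exists>m<n. \<zeta> k \<omega> = enat m \<and> wait_time P l X (Suc k) m \<omega> = enat (n - m)"
    by (intro exI[of _ m]) simp
qed auto

text \<open>The blocks read at \<open>\<zeta> k\<close> have length at most \<open>k + 1\<close>, so by this bound they do not reach back
  beyond time \<open>0\<close>, where the observations start.\<close>
lemma zeta_ge: "\<zeta> k \<omega> = enat n \<Longrightarrow> k \<le> n"
proof (induction k arbitrary: n)
  case (Suc k)
  then show ?case unfolding zeta_Suc_eq_enat_iff by fastforce
qed simp

lemma zeta_strict_mono:
  assumes "i < j" "\<zeta> j \<omega> = enat n"
  shows "\<exists>m<n. \<zeta> i \<omega> = enat m"
  using assms
proof (induction j arbitrary: n)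
  case (Suc j)
  from Suc.prems(2) obtain m where m: "m < n" "\<zeta> j \<omega> = enat m"
    unfolding zeta_Suc_eq_enat_iff by blast
  show ?case
  proof (cases "i = j")
    case True
    then show ?thesis using m by blast
  next
    case False
    then obtain m' where "m' < m" "\<zeta> i \<omega> = enat m'" using Suc.IH[OF _ m(2)] Suc.prems(1) by auto
    then show ?thesis using m by (intro exI[of _ m']) auto
  qed
qed simp

lemma measurable_block_code_trajectory_F:
  assumes "1 \<le> k" "k \<le> Suc m" "m \<le> n"
  shows "(\<lambda>\<omega>. block_code P l k (trajectory X (int m) \<omega>)) \<in> F (enat n) \<rightarrow>\<^sub>M count_space UNIV"
proof (rule measurable_block_code_compose)
  fix i assume i: "i < l k"
  have "l k \<le> k" using l assms(1) by (simp add: block_lengths_def)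
  then have "i \<le> m" using i assms(2) by simp
  then have "trajectory X (int m) \<omega> (- int i) = X (int (m - i)) \<omega>" for \<omega>
    by (simp add: trajectory_def of_nat_diff add.commute)
  then show "(\<lambda>\<omega>. trajectory X (int m) \<omega> (- int i)) \<in> borel_measurable (F (enat n))"
    using measurable_X_F[of "m - i" "enat n"] assms(3) by simp
qed

lemma pred_zeta_eq: "Measurable.pred (F (enat n)) (\<lambda>\<omega>. \<zeta> k \<omega> = enat n)"
proof (induction k arbitrary: n)
  case 0
  then show ?case by (auto simp: zero_enat_def)
next
  case (Suc k)
  have "Measurable.pred (F (enat n)) (\<lambda>\<omega>. \<exists>m\<in>{k..<n}. \<zeta> k \<omega> = enat m \<and>
      wait_time P l X (Suc k) m \<omega> = enat (n - m))"
  proof (intro pred_intros_finite(4) pred_intros_logic)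
    fix m assume m: "m \<in> {k..<n}"
    show "Measurable.pred (F (enat n)) (\<lambda>\<omega>. \<zeta> k \<omega> = enat m)"
      using Suc.IH[of m] obs.sets_F_mono[of "enat m" "enat n"] m
      by (auto simp: pred_def obs.space_F)
    have [measurable]: "(\<lambda>\<omega>. block_code P l (Suc k) (trajectory X (int m + int s) \<omega>)) \<in> F (enat n) \<rightarrow>\<^sub>M count_space UNIV"
      if "s \<le> n - m" for s
    proof -
      have le: "m + s \<le> n" using m that by auto
      show ?thesis
        using measurable_block_code_trajectory_F[of "Suc k" "m + s" n] m le by simp
    qed
    note [measurable] = this[of 0, simplified]
    show "Measurable.pred (F (enat n)) (\<lambda>\<omega>. wait_time P l X (Suc k) m \<omega> = enat (n - m))"
      by (subst wait_time_eq_enat_iff) measurable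
  qed simp
  also have "(\<lambda>\<omega>. \<exists>m\<in>{k..<n}. \<zeta> k \<omega> = enat m \<and> wait_time P l X (Suc k) m \<omega> = enat (n - m))
    = (\<lambda>\<omega>. \<zeta> (Suc k) \<omega> = enat n)"
    unfolding zeta_Suc_eq_enat_iff using zeta_ge by (auto simp: fun_eq_iff Bex_def)
  finally show ?case .
qed

lemma stopping_time_zeta: "stopping_time F (\<zeta> k)"
proof (rule stopping_timeI)
  fix t
  show "Measurable.pred (F t) (\<lambda>\<omega>. \<zeta> k \<omega> \<le> t)"
  proof (cases t)
    case (enat n)
    have "Measurable.pred (F (enat n)) (\<lambda>\<omega>. \<exists>m\<in>{..n}. \<zeta> k \<omega> = enat m)"
    proof (intro pred_intros_finite(4))
      fix m assume m: "m \<in> {..n}"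
      show "Measurable.pred (F (enat n)) (\<lambda>\<omega>. \<zeta> k \<omega> = enat m)"
        using pred_zeta_eq[where k=k and n=m] obs.sets_F_mono[of "enat m" "enat n"] m
        by (auto simp: pred_def obs.space_F)
    qed simp
    also have "(\<lambda>\<omega>. \<exists>m\<in>{..n}. \<zeta> k \<omega> = enat m) = (\<lambda>\<omega>. \<zeta> k \<omega> \<le> enat n)"
      using enat_ile by (fastforce simp: fun_eq_iff)
    finally show ?thesis using enat by simp
  qed simp
qed

lemma measurable_stopped:
  "(\<And>t. G t \<in> F t \<rightarrow>\<^sub>M N) \<Longrightarrow> (\<lambda>\<omega>. G (\<zeta> k \<omega>) \<omega>) \<in> FS k \<rightarrow>\<^sub>M N"
  unfolding stopped_algebra_def
  by (rule obs.measurable_pre_sigma_countable[OF stopping_time_zeta]) auto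

lemma sets_FS: "sets (FS k) = {A. \<forall>t. {\<omega>\<in>A. \<zeta> k \<omega> \<le> t} \<in> sets (F t)}"
  unfolding stopped_algebra_def by (rule obs.sets_pre_sigma[OF stopping_time_zeta])

lemma subalgebra_FS: "subalgebra M (FS k)"
proof -
  have "A \<in> sets M" if "A \<in> sets (FS k)" for A
  proof -
    have "{\<omega>\<in>A. \<zeta> k \<omega> \<le> \<infinity>} \<in> sets (F \<infinity>)" using that unfolding sets_FS by blast
    then show ?thesis using sets_F_subset by auto
  qed
  then show ?thesis
    unfolding subalgebra_def by (auto simp: stopped_algebra_def obs.space_pre_sigma)
qed

sublocale FS: finite_measure_subalgebra M "FS k" for k
  by unfold_locales (rule subalgebra_FS)

text \<open>At time \<open>t\<close> one knows the stopping time as far as it has already occurred.\<close>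
lemma measurable_zeta_F: "(\<lambda>\<omega>. min (\<zeta> k \<omega>) t) \<in> F t \<rightarrow>\<^sub>M count_space UNIV"
proof -
  have "Measurable.pred (F t) (\<lambda>\<omega>. min (\<zeta> k \<omega>) t = s)" for s
  proof -
    have eq: "Measurable.pred (F t) (\<lambda>\<omega>. \<zeta> k \<omega> = s)" if "s \<le> t"
      using obs.stopping_time_eq_const[OF stopping_time_zeta, of k s] obs.sets_F_mono[OF that]
      by (auto simp: pred_def obs.space_F)
    consider "s < t" | "s = t" | "t < s" by fastforce
    then show ?thesis
    proof cases
      case 1
      then have "(\<lambda>\<omega>. min (\<zeta> k \<omega>) t = s) = (\<lambda>\<omega>. \<zeta> k \<omega> = s)" by (auto simp: min_def)
      then show ?thesis using eq 1 by simp
    next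
      case 2
      then have "(\<lambda>\<omega>. min (\<zeta> k \<omega>) t = s) = (\<lambda>\<omega>. \<not> \<zeta> k \<omega> < t)" by (auto simp: min_def)
      moreover have "Measurable.pred (F t) (\<lambda>\<omega>. \<not> \<zeta> k \<omega> < t)"
        using obs.stopping_time_less_const[OF stopping_time_zeta] by (rule pred_intros_logic(2))
      ultimately show ?thesis by simp
    next
      case 3
      then have "(\<lambda>\<omega>. min (\<zeta> k \<omega>) t = s) = (\<lambda>\<omega>. False)" by (auto simp: min_def)
      then show ?thesis by simp
    qed
  qed
  then have "{\<omega> \<in> space (F t). min (\<zeta> k \<omega>) t = s} \<in> sets (F t)" for s
    by (rule predE)
  moreover have "(\<lambda>\<omega>. min (\<zeta> k \<omega>) t) -` {s} \<inter> space (F t) = {\<omega> \<in> space (F t). min (\<zeta> k \<omega>) t = s}" for s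
    by auto
  ultimately show ?thesis
    by (simp add: measurable_count_space_eq2_countable)
qed

lemma measurable_zeta[measurable]: "\<zeta> k \<in> M \<rightarrow>\<^sub>M count_space UNIV"
proof -
  have "(\<lambda>\<omega>. \<zeta> k \<omega>) \<in> F \<infinity> \<rightarrow>\<^sub>M count_space UNIV"
    using measurable_zeta_F[of k \<infinity>] by (simp add: min_def)
  then show ?thesis
    by (rule measurable_from_subalg[rotated]) (simp add: subalgebra_def obs.space_F sets_F_subset)
qed

text \<open>The stopping times increase strictly while they are finite, so the observation that follows the
  \<open>i\<close>-th one has been made by the \<open>j\<close>-th.\<close>
lemma measurable_next_obs:
  assumes "i < j"
  shows "next_obs P l X i \<in> borel_measurable (FS j)"
proof -
  define G where "G t \<omega> = (if t = \<infinity> \<or> \<zeta> i \<omega> < t then next_obs P l X i \<omega> else 0)" for t \<omega>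
  have "G t \<in> borel_measurable (F t)" for t
  proof -
    \<comment> \<open>for \<open>t < \<infinity>\<close> only the cases \<open>\<zeta> i < t\<close> matter, and there \<open>min (\<zeta> i) t\<close> is \<open>\<zeta> i\<close>\<close>
    define H where "H s \<omega> = (if t = \<infinity> \<or> s < t then X (int (the_enat s) + 1) \<omega> else 0)" for s \<omega>
    have "H s \<in> borel_measurable (F t)" for s
    proof (cases "t = \<infinity> \<or> s < t")
      case True
      then have "enat (Suc (the_enat s)) \<le> t" by (cases s; cases t) auto
      from measurable_X_F[OF this] True show ?thesis by (simp add: H_def[abs_def] add.commute)
    next
      case False
      then have "H s = (\<lambda>_. 0)" by (auto simp: fun_eq_iff H_def)
      then show ?thesis by simp
    qed
    then have "(\<lambda>\<omega>. H (min (\<zeta> i \<omega>) t) \<omega>) \<in> borel_measurable (F t)"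
      by (rule measurable_compose_countable[OF _ measurable_zeta_F])
    also have "(\<lambda>\<omega>. H (min (\<zeta> i \<omega>) t) \<omega>) = G t"
      by (auto simp: fun_eq_iff H_def G_def next_obs_def min_def)
    finally show ?thesis .
  qed
  then have "(\<lambda>\<omega>. G (\<zeta> j \<omega>) \<omega>) \<in> borel_measurable (FS j)"
    by (rule measurable_stopped)
  also have "(\<lambda>\<omega>. G (\<zeta> j \<omega>) \<omega>) = next_obs P l X i"
    using zeta_strict_mono[OF assms] by (fastforce simp: fun_eq_iff G_def)
  finally show ?thesis .
qed

text \<open>Where \<open>\<zeta> j\<close> is infinite the recentred block may extend into the negative times, which are never observed;
  the value \<open>0\<close> keeps the function measurable for the observations there.\<close>
lemma measurable_block_function:
  fixes v :: "(int \<Rightarrow> real) \<Rightarrow> real"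
  assumes v: "\<And>x y. block_code P l m x = block_code P l m y \<Longrightarrow> v x = v y" and m: "1 \<le> m" "m \<le> j"
  shows "(\<lambda>\<omega>. if \<zeta> j \<omega> = \<infinity> then 0 else v (view j \<omega>)) \<in> borel_measurable (FS j)"
proof -
  \<comment> \<open>a function of the block factors through the countable type of block codes\<close>
  define c where "c d = v (SOME x. block_code P l m x = d)" for d
  have vc: "v x = c (block_code P l m x)" for x
    unfolding c_def
  proof (rule v)
    show "block_code P l m x = block_code P l m (SOME y. block_code P l m y = block_code P l m x)"
      using someI[of "\<lambda>y. block_code P l m y = block_code P l m x" x] by simp
  qed
  define G where "G t \<omega> = (if t = \<infinity> \<or> t < enat j then 0 else v (trajectory X (int (the_enat t)) \<omega>))" for t \<omega>
  have "G t \<in> borel_measurable (F t)" for t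
  proof (cases "t = \<infinity> \<or> t < enat j")
    case False
    then obtain n where n: "t = enat n" "j \<le> n" by (cases t) auto
    have "(\<lambda>\<omega>. c (block_code P l m (trajectory X (int n) \<omega>))) \<in> borel_measurable (F t)"
      unfolding n by (rule measurable_compose[OF measurable_block_code_trajectory_F]) (use m n in auto)
    then show ?thesis using False n by (simp add: G_def[abs_def] vc)
  qed (simp add: G_def[abs_def])
  then have "(\<lambda>\<omega>. G (\<zeta> j \<omega>) \<omega>) \<in> borel_measurable (FS j)"
    by (rule measurable_stopped)
  also have "(\<lambda>\<omega>. G (\<zeta> j \<omega>) \<omega>) = (\<lambda>\<omega>. if \<zeta> j \<omega> = \<infinity> then 0 else v (view j \<omega>))"
  proof
    fix \<omega>
    show "G (\<zeta> j \<omega>) \<omega> = (if \<zeta> j \<omega> = \<infinity> then 0 else v (view j \<omega>))"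
      using zeta_ge[of j \<omega>] by (cases "\<zeta> j \<omega>") (auto simp: G_def view_def)
  qed
  finally show ?thesis .
qed

lemma measurable_view[measurable]: "view k \<in> M \<rightarrow>\<^sub>M Seq"
  unfolding view_def[abs_def]
  by (rule measurable_compose_countable[where f="\<lambda>t. trajectory X (int (the_enat t))", OF measurable_trajectory[OF measurable_X] measurable_zeta])

definition law :: "(int \<Rightarrow> real) measure" where
  "law = distr M Seq (trajectory X 0)"

lemma sets_law[simp, measurable_cong]: "sets law = sets Seq" by (simp add: law_def)
lemma space_law[simp]: "space law = UNIV" by (simp add: law_def space_Seq)

lemma prob_space_law: "prob_space law"
  unfolding law_def by (intro prob_space_distr measurable_trajectory) simp

lemma distr_trajectory: "distr M Seq (trajectory X n) = law"
  unfolding law_def by (rule stationary_distr_trajectory[OF prob_space_axioms stationary])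

lemma distr_time_shift_law: "distr law law (time_shift n) = law"
proof -
  have "distr law law (time_shift n) = distr (distr M Seq (trajectory X 0)) Seq (time_shift n)"
    unfolding law_def by (rule distr_cong) auto
  also have "\<dots> = distr M Seq (time_shift n \<circ> trajectory X 0)"
    by (intro distr_distr measurable_time_shift measurable_trajectory) simp
  also have "time_shift n \<circ> trajectory X 0 = trajectory X n"
    by (simp add: fun_eq_iff time_shift_trajectory)
  finally show ?thesis by (simp add: distr_trajectory)
qed

text \<open>Each step from one stopping time to the next is an application of a first-return map, and the recurrence
  statement shows that the waiting time is almost surely finite.\<close>
proposition distr_view: "(AE \<omega> in M. \<zeta> k \<omega> \<noteq> \<infinity>) \<and> distr M Seq (view k) = law"
proof (induction k)
  case 0
  have "view 0 = trajectory X 0" by (simp add: view_def fun_eq_iff zero_enat_def)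
  then show ?case by (simp add: law_def)
next
  case (Suc k)
  interpret law: prob_space law by (rule prob_space_law)
  let ?b = "block_code P l (Suc k)"
  have time_shift[measurable]: "time_shift 1 \<in> law \<rightarrow>\<^sub>M law"
    using measurable_time_shift by (simp cong: measurable_cong_sets)
  have b[measurable]: "?b \<in> law \<rightarrow>\<^sub>M count_space UNIV"
    using measurable_block_code by (simp cong: measurable_cong_sets)
  note ret = law.return_map_preserves[OF time_shift distr_time_shift_law b]
  have R[measurable]: "return_map (time_shift 1) ?b \<in> Seq \<rightarrow>\<^sub>M Seq"
    using measurable_return_map[OF time_shift b] by (simp cong: measurable_cong_sets)
  have "AE x in distr M Seq (view k). \<exists>t>0. ?b ((time_shift 1 ^^ t) x) = ?b x"
    by (simp only: Suc.IH[THEN conjunct2] ret(1))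
  then have "AE \<omega> in M. \<exists>t>0. ?b ((time_shift 1 ^^ t) (view k \<omega>)) = ?b (view k \<omega>)"
    by (rule AE_distrD[OF measurable_view])
  with Suc.IH[THEN conjunct1] have ae: "AE \<omega> in M. \<zeta> (Suc k) \<omega> \<noteq> \<infinity> \<and> view (Suc k) \<omega> = return_map (time_shift 1) ?b (view k \<omega>)"
  proof eventually_elim
    case (elim \<omega>)
    then obtain n where n: "\<zeta> k \<omega> = enat n" by auto
    have v: "view k \<omega> = trajectory X (int n) \<omega>" by (simp add: view_def n)
    define r where "r = return_time (time_shift 1) ?b (view k \<omega>)"
    have "wait_time P l X (Suc k) n \<omega> = enat r"
    proof (subst wait_time_eq_enat_iff, simp, intro conjI ballI)
      show "0 < r"
        unfolding r_def by (rule return_time(1)[of ?b "time_shift 1" "view k \<omega>", OF elim(2)])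
      show "?b (trajectory X (int n + int r) \<omega>) = ?b (trajectory X (int n) \<omega>)"
        using return_time(2)[of ?b "time_shift 1" "view k \<omega>", OF elim(2)]
        by (simp add: return_map_def time_shift_funpow v time_shift_trajectory r_def)
      fix s assume "s \<in> {0<..<r}"
      then show "?b (trajectory X (int n + int s) \<omega>) \<noteq> ?b (trajectory X (int n) \<omega>)"
        using not_less_Least[of s "\<lambda>t. 0 < t \<and> ?b ((time_shift 1 ^^ t) (view k \<omega>)) = ?b (view k \<omega>)"]
        by (simp add: r_def return_time_def time_shift_funpow v time_shift_trajectory)
    qed
    then have "\<zeta> (Suc k) \<omega> = enat (n + r)" by (simp add: n)
    then show ?case
      by (simp add: view_def[of "Suc k"] return_map_def time_shift_funpow r_def time_shift_trajectory v del: zeta.simps)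
  qed
  have "distr M Seq (view (Suc k)) = distr M Seq (return_map (time_shift 1) ?b \<circ> view k)"
  proof (rule distr_cong_AE)
    show "AE \<omega> in M. view (Suc k) \<omega> = (return_map (time_shift 1) ?b \<circ> view k) \<omega>"
      using ae by eventually_elim simp
  qed auto
  also have "\<dots> = distr (distr M Seq (view k)) Seq (return_map (time_shift 1) ?b)"
    by (rule distr_distr[symmetric]) auto
  also have "\<dots> = distr law law (return_map (time_shift 1) ?b)"
    using Suc by (intro distr_cong) auto
  finally show ?case using ae ret(2) by auto
qed

text \<open>The waiting time after \<open>\<zeta> j\<close> ends when the block of level \<open>j + 1\<close> recurs, and with it every block of a
  lower level.\<close>
lemma block_code_view_stable:
  assumes "1 \<le> m" "m \<le> j" "\<zeta> j \<omega> \<noteq> \<infinity>"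
  shows "block_code P l m (view j \<omega>) = block_code P l m (view m \<omega>)"
  using assms(2,3)
proof (induction j rule: dec_induct)
  case (step j)
  from step.prems obtain n' where "\<zeta> (Suc j) \<omega> = enat n'" by auto
  then obtain n where n: "n < n'" "\<zeta> j \<omega> = enat n" "wait_time P l X (Suc j) n \<omega> = enat (n' - n)"
    unfolding zeta_Suc_eq_enat_iff by blast
  then have "block_code P l (Suc j) (trajectory X (int n + int (n' - n)) \<omega>) = block_code P l (Suc j) (trajectory X (int n) \<omega>)"
    using wait_time_eq_enat_iff[of "Suc j" X n \<omega> "n' - n"] by simp
  moreover have "int n + int (n' - n) = int n'" using n(1) by simp
  moreover have "view (Suc j) \<omega> = trajectory X (int n') \<omega>" "view j \<omega> = trajectory X (int n) \<omega>"
    by (simp_all only: view_def \<open>\<zeta> (Suc j) \<omega> = enat n'\<close> n(2) the_enat.simps)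
  ultimately have "block_code P l (Suc j) (view (Suc j) \<omega>) = block_code P l (Suc j) (view j \<omega>)"
    by (simp only:)
  then have "block_code P l m (view (Suc j) \<omega>) = block_code P l m (view j \<omega>)"
    by (rule block_code_eq_mono[OF assms(1), rotated]) (use step.hyps in simp)
  then show ?case using step.IH n by simp
qed simp

end

section \<open>Density of lattices of square-integrable functions\<close>

text \<open>A vector lattice of square-integrable functions with the constants is dense, in mean square, in the
  square-integrable functions measurable for a \<open>\<sigma>\<close>-algebra generated by sets whose indicators belong to
  the lattice. This gives the convergence of conditional expectations along an increasing family of
  \<open>\<sigma>\<close>-algebras in the form in which it is needed, without martingales.\<close>
locale L2_lattice = finite_measure N for N :: "'b measure" +
  fixes V :: "('b \<Rightarrow> real) set"
  assumes V_L2: "V \<subseteq> L2 N"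
    and V_const: "\<And>c. (\<lambda>_. c) \<in> V"
    and V_add: "\<And>v w. v \<in> V \<Longrightarrow> w \<in> V \<Longrightarrow> (\<lambda>x. v x + w x) \<in> V"
    and V_cmult: "\<And>v c. v \<in> V \<Longrightarrow> (\<lambda>x. c * v x) \<in> V"
    and V_max: "\<And>v w. v \<in> V \<Longrightarrow> w \<in> V \<Longrightarrow> (\<lambda>x. max (v x) (w x)) \<in> V"
begin

definition approximable :: "('b \<Rightarrow> real) \<Rightarrow> bool" where
  "approximable f \<longleftrightarrow> f \<in> L2 N \<and> (\<forall>e>0. \<exists>v\<in>V. (\<integral>x. (f x - v x)\<^sup>2 \<partial>N) < e)"

lemma approximableD: "approximable f \<Longrightarrow> f \<in> L2 N"
  "approximable f \<Longrightarrow> 0 < e \<Longrightarrow> \<exists>v\<in>V. (\<integral>x. (f x - v x)\<^sup>2 \<partial>N) < e"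
  by (auto simp: approximable_def)

lemma approximable_V: "v \<in> V \<Longrightarrow> approximable v"
  using V_L2 by (auto simp: approximable_def intro!: bexI[of _ v])

lemma approximable_limit:
  assumes f: "f \<in> L2 N" and lim: "\<And>e. 0 < e \<Longrightarrow> \<exists>g. approximable g \<and> (\<integral>x. (f x - g x)\<^sup>2 \<partial>N) < e"
  shows "approximable f"
  unfolding approximable_def
proof (intro conjI allI impI f)
  fix e :: real assume "0 < e"
  then obtain g where g: "approximable g" "(\<integral>x. (f x - g x)\<^sup>2 \<partial>N) < e / 4"
    using lim[of "e / 4"] by auto
  obtain v where v: "v \<in> V" "(\<integral>x. (g x - v x)\<^sup>2 \<partial>N) < e / 4"
    using approximableD(2)[OF g(1), of "e / 4"] \<open>0 < e\<close> by auto
  have "(\<integral>x. ((f x - g x) + (g x - v x))\<^sup>2 \<partial>N)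
      \<le> 2 * (\<integral>x. (f x - g x)\<^sup>2 \<partial>N) + 2 * (\<integral>x. (g x - v x)\<^sup>2 \<partial>N)"
    using f approximableD(1)[OF g(1)] v(1) V_L2 by (intro integral_square_add_le L2_diff) auto
  then show "\<exists>v\<in>V. (\<integral>x. (f x - v x)\<^sup>2 \<partial>N) < e"
    using g(2) v by (intro bexI[of _ v]) auto
qed

lemma approximable_pointwise_limit:
  assumes s: "\<And>i. approximable (s i)" and f: "f \<in> L2 N" and w: "w \<in> L2 N"
    and bound: "\<And>i x. x \<in> space N \<Longrightarrow> \<bar>f x - s i x\<bar> \<le> w x"
    and lim: "\<And>x. x \<in> space N \<Longrightarrow> (\<lambda>i. s i x) \<longlonglongrightarrow> f x"
  shows "approximable f"
proof (rule approximable_limit[OF f])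
  fix e :: real assume "0 < e"
  have "(\<lambda>i. \<integral>x. (f x - s i x)\<^sup>2 \<partial>N) \<longlonglongrightarrow> (\<integral>x. 0 \<partial>N)"
  proof (rule integral_dominated_convergence)
    show "integrable N (\<lambda>x. (w x)\<^sup>2)" by (rule L2D(2)[OF w])
    show "(\<lambda>x. (f x - s i x)\<^sup>2) \<in> borel_measurable N" for i
      using L2D(1)[OF f] L2D(1)[OF approximableD(1)[OF s]] by auto
    show "AE x in N. (\<lambda>i. (f x - s i x)\<^sup>2) \<longlonglongrightarrow> 0"
    proof (rule AE_I2)
      fix x assume "x \<in> space N"
      then have "(\<lambda>i. (f x - s i x)\<^sup>2) \<longlonglongrightarrow> (f x - f x)\<^sup>2"
        using lim by (intro tendsto_intros)
      then show "(\<lambda>i. (f x - s i x)\<^sup>2) \<longlonglongrightarrow> 0" by simp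
    qed
    show "AE x in N. norm ((f x - s i x)\<^sup>2) \<le> (w x)\<^sup>2" for i
    proof (rule AE_I2)
      fix x assume "x \<in> space N"
      then have "\<bar>f x - s i x\<bar>\<^sup>2 \<le> (w x)\<^sup>2" using bound by (intro power_mono) auto
      then show "norm ((f x - s i x)\<^sup>2) \<le> (w x)\<^sup>2" by simp
    qed
  qed simp
  then have "\<forall>\<^sub>F i in sequentially. (\<integral>x. (f x - s i x)\<^sup>2 \<partial>N) < e"
    using \<open>0 < e\<close> by (intro order_tendstoD) auto
  then obtain i where "(\<integral>x. (f x - s i x)\<^sup>2 \<partial>N) < e"
    using eventually_happens'[OF sequentially_bot] by blast
  then show "\<exists>g. approximable g \<and> (\<integral>x. (f x - g x)\<^sup>2 \<partial>N) < e" using s by blast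
qed

lemma approximable_cong:
  assumes f: "approximable f" and "\<And>x. x \<in> space N \<Longrightarrow> f x = g x"
  shows "approximable g"
proof -
  have "g \<in> borel_measurable N"
    using L2D(1)[OF approximableD(1)[OF f]] measurable_cong[of N f g] assms(2) by auto
  then have "g \<in> L2 N"
    using assms(2) by (intro L2_bounded_by[OF approximableD(1)[OF f]]) auto
  then show ?thesis
    using assms by (intro approximable_pointwise_limit[OF f _ L2_zero]) auto
qed

lemma approximable_add:
  assumes f: "approximable f" and g: "approximable g"
  shows "approximable (\<lambda>x. f x + g x)"
  unfolding approximable_def
proof (intro conjI allI impI L2_add approximableD(1) f g)
  fix e :: real assume "0 < e"
  obtain v where v: "v \<in> V" "(\<integral>x. (f x - v x)\<^sup>2 \<partial>N) < e / 4"
    using approximableD(2)[OF f, of "e / 4"] \<open>0 < e\<close> by auto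
  obtain w where w: "w \<in> V" "(\<integral>x. (g x - w x)\<^sup>2 \<partial>N) < e / 4"
    using approximableD(2)[OF g, of "e / 4"] \<open>0 < e\<close> by auto
  have "(\<integral>x. ((f x - v x) + (g x - w x))\<^sup>2 \<partial>N)
      \<le> 2 * (\<integral>x. (f x - v x)\<^sup>2 \<partial>N) + 2 * (\<integral>x. (g x - w x)\<^sup>2 \<partial>N)"
    using approximableD(1)[OF f] approximableD(1)[OF g] v(1) w(1) V_L2
    by (intro integral_square_add_le L2_diff) auto
  then show "\<exists>u\<in>V. (\<integral>x. (f x + g x - u x)\<^sup>2 \<partial>N) < e"
    using v w by (intro bexI[OF _ V_add[OF v(1) w(1)]]) (auto simp: algebra_simps)
qed

lemma approximable_cmult:
  assumes f: "approximable f"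
  shows "approximable (\<lambda>x. c * f x)"
  unfolding approximable_def
proof (intro conjI allI impI L2_cmult approximableD(1) f)
  fix e :: real assume "0 < e"
  moreover have pos: "0 < c\<^sup>2 + 1" by (simp add: add_nonneg_pos)
  ultimately obtain v where v: "v \<in> V" "(\<integral>x. (f x - v x)\<^sup>2 \<partial>N) < e / (c\<^sup>2 + 1)"
    using approximableD(2)[OF f, of "e / (c\<^sup>2 + 1)"] by auto
  have "(\<integral>x. (c * f x - c * v x)\<^sup>2 \<partial>N) = c\<^sup>2 * (\<integral>x. (f x - v x)\<^sup>2 \<partial>N)"
    by (simp flip: right_diff_distrib add: power_mult_distrib)
  also have "\<dots> \<le> (c\<^sup>2 + 1) * (\<integral>x. (f x - v x)\<^sup>2 \<partial>N)"
    by (intro mult_right_mono) auto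
  also have "\<dots> < e" using v(2) pos by (simp add: field_simps)
  finally show "\<exists>u\<in>V. (\<integral>x. (c * f x - u x)\<^sup>2 \<partial>N) < e"
    by (intro bexI[OF _ V_cmult[OF v(1)]])
qed

lemma approximable_max:
  assumes f: "approximable f" and g: "approximable g"
  shows "approximable (\<lambda>x. max (f x) (g x))"
  unfolding approximable_def
proof (intro conjI allI impI L2_max approximableD(1) f g)
  fix e :: real assume "0 < e"
  obtain v where v: "v \<in> V" "(\<integral>x. (f x - v x)\<^sup>2 \<partial>N) < e / 2"
    using approximableD(2)[OF f, of "e / 2"] \<open>0 < e\<close> by auto
  obtain w where w: "w \<in> V" "(\<integral>x. (g x - w x)\<^sup>2 \<partial>N) < e / 2"
    using approximableD(2)[OF g, of "e / 2"] \<open>0 < e\<close> by auto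
  have L2: "f \<in> L2 N" "g \<in> L2 N" "v \<in> L2 N" "w \<in> L2 N"
    using approximableD(1)[OF f] approximableD(1)[OF g] v(1) w(1) V_L2 by auto
  have sq: "(max a b - max c d)\<^sup>2 \<le> (a - c)\<^sup>2 + (b - d)\<^sup>2" for a b c d :: real
  proof -
    have "\<bar>max a b - max c d\<bar> \<le> max \<bar>a - c\<bar> \<bar>b - d\<bar>" by linarith
    then consider "\<bar>max a b - max c d\<bar> \<le> \<bar>a - c\<bar>" | "\<bar>max a b - max c d\<bar> \<le> \<bar>b - d\<bar>" by linarith
    then show ?thesis by cases (simp_all add: abs_le_square_iff add_increasing add_increasing2)
  qed
  have "(\<integral>x. (max (f x) (g x) - max (v x) (w x))\<^sup>2 \<partial>N) \<le> (\<integral>x. (f x - v x)\<^sup>2 + (g x - w x)\<^sup>2 \<partial>N)"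
    using L2 sq by (intro integral_mono Bochner_Integration.integrable_add L2D(2)[OF L2_diff] L2_max)
  also have "\<dots> = (\<integral>x. (f x - v x)\<^sup>2 \<partial>N) + (\<integral>x. (g x - w x)\<^sup>2 \<partial>N)"
    using L2 by (intro Bochner_Integration.integral_add L2D(2)[OF L2_diff])
  also have "\<dots> < e" using v w by simp
  finally show "\<exists>u\<in>V. (\<integral>x. (max (f x) (g x) - u x)\<^sup>2 \<partial>N) < e"
    by (intro bexI[OF _ V_max[OF v(1) w(1)]])
qed

lemma approximable_sum:
  "(\<And>i. i \<in> I \<Longrightarrow> approximable (f i)) \<Longrightarrow> approximable (\<lambda>x. \<Sum>i\<in>I. f i x)"
  by (induction I rule: infinite_finite_induct) (auto intro: approximable_V V_const approximable_add)

text \<open>The lattice operation enters through finite unions, the indicator of a union being a maximum; a countable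
  union is a pointwise limit of finite ones.\<close>
lemma approximable_indicator:
  assumes gen: "\<And>A. A \<in> \<A> \<Longrightarrow> A \<subseteq> space N \<and> indicator A \<in> V" and A: "A \<in> sigma_sets (space N) \<A>"
  shows "approximable (indicator A)"
  using A
proof induction
  case (Basic A)
  then show ?case using gen by (auto intro: approximable_V)
next
  case Empty
  show ?case using approximable_V[OF V_const[of 0]] by (rule approximable_cong) simp
next
  case (Compl A)
  have "approximable (\<lambda>x. 1 + - 1 * indicator A x)"
    by (intro approximable_add approximable_cmult Compl.IH approximable_V[OF V_const])
  then show ?case by (rule approximable_cong) (simp add: indicator_def)
next
  case (Union A)
  have part: "approximable (indicator (\<Union>i<n. A i))" for n
  proof (induction n)
    case 0
    show ?case using approximable_V[OF V_const[of 0]] by (rule approximable_cong) simp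
  next
    case (Suc n)
    then have "approximable (\<lambda>x. max (indicator (\<Union>i<n. A i) x) (indicator (A n) x))"
      using Union.IH by (intro approximable_max)
    then show ?case
      by (rule approximable_cong) (auto simp: indicator_def less_Suc_eq split: if_splits)
  qed
  have "A i \<in> sets N" for i
  proof -
    have "A i = {x \<in> space N. indicator (A i) x = (1::real)}"
      using sigma_sets_into_sp[OF _ Union.hyps[of i]] gen by (auto simp: indicator_def)
    also have "\<dots> \<in> sets N"
      using L2D(1)[OF approximableD(1)[OF Union.IH[of i]]] by measurable
    finally show ?thesis .
  qed
  then have "indicator (\<Union>i. A i) \<in> L2 N"
    by (intro L2_bounded_by[OF L2_const[of 1]]) (auto simp: indicator_def)
  then show ?case
  proof (rule approximable_pointwise_limit[OF part _ L2_const])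
    show "\<bar>indicator (\<Union>i. A i) x - indicator (\<Union>i<n. A i) x\<bar> \<le> (1::real)" for x n
      by (simp add: indicator_def)
    show "(\<lambda>n. indicator (\<Union>i<n. A i) x) \<longlonglongrightarrow> (indicator (\<Union>i. A i) x :: real)" for x
      by (rule LIMSEQ_indicator_UN)
  qed
qed

proposition approximable_measurable:
  assumes gen: "\<And>A. A \<in> \<A> \<Longrightarrow> A \<subseteq> space N \<and> indicator A \<in> V"
    and f: "f \<in> L2 N" "f \<in> borel_measurable (sigma (space N) \<A>)"
  shows "approximable f"
proof -
  let ?G = "sigma (space N) \<A>"
  have sets_G: "sets ?G = sigma_sets (space N) \<A>"
    using gen by (intro sets_measure_of) auto
  have space_G: "space ?G = space N"
    by (rule space_measure_of) (use gen in auto)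
  obtain s where s: "\<forall>i. simple_function ?G (s i)" "\<forall>x\<in>space N. (\<lambda>i. s i x) \<longlonglongrightarrow> f x"
    "\<forall>i. \<forall>x\<in>space N. \<bar>s i x\<bar> \<le> 2 * \<bar>f x\<bar>"
    using borel_measurable_implies_sequence_metric[OF f(2), of 0]
    unfolding space_G dist_real_def diff_0_right by (elim exE conjE)
  note s = s[rule_format]
  have "approximable (s i)" for i
  proof (rule approximable_cong)
    show "approximable (\<lambda>x. \<Sum>y\<in>s i ` space N. y * indicator (s i -` {y} \<inter> space N) x)"
    proof (intro approximable_sum approximable_cmult approximable_indicator[of \<A>] gen)
      fix y
      show "s i -` {y} \<inter> space N \<in> sigma_sets (space N) \<A>"
        using simple_functionD(2)[OF s(1), of i "{y}"] by (simp add: sets_G space_G)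
    qed
    show "(\<Sum>y\<in>s i ` space N. y * indicator (s i -` {y} \<inter> space N) x) = s i x" if "x \<in> space N" for x
    proof -
      have "(\<Sum>y\<in>s i ` space N. y * indicator (s i -` {y} \<inter> space N) x)
          = (\<Sum>y\<in>s i ` space N. indicator (s i -` {y} \<inter> space N) x *\<^sub>R y)"
        by (rule sum.cong) simp_all
      also have "\<dots> = s i x"
        by (rule simple_function_indicator_representation_banach[OF s(1), of x i, unfolded space_G, OF that, symmetric])
      finally show ?thesis .
    qed
  qed
  then show ?thesis
  proof (rule approximable_pointwise_limit[OF _ f(1)])
    show "(\<lambda>x. 3 * \<bar>f x\<bar>) \<in> L2 N" using f(1) by (intro L2_cmult) (auto simp: L2_def)
    show "\<bar>f x - s i x\<bar> \<le> 3 * \<bar>f x\<bar>" if "x \<in> space N" for i x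
      using s(3)[OF that, of i] by linarith
  qed (rule s(2))
qed

end

section \<open>Regression on the infinite past\<close>

context intermittent_scheme begin

text \<open>The past is generated by the quantized blocks rather than by the coordinates; that it contains the
  coordinates up to time \<open>0\<close> is where the shrinking of the cells and the growth of the blocks are
  used.\<close>
definition past_events :: "(int \<Rightarrow> real) set set" where
  "past_events = {block_code P l m -` Y | m Y. 1 \<le> m}"

definition Past :: "(int \<Rightarrow> real) measure" where
  "Past = sigma UNIV past_events"

definition regression :: "(int \<Rightarrow> real) \<Rightarrow> real" where
  "regression = real_cond_exp law Past (\<lambda>x. x 1)"

definition blockwise :: "nat \<Rightarrow> ((int \<Rightarrow> real) \<Rightarrow> real) \<Rightarrow> bool" where
  "blockwise m v \<longleftrightarrow> (\<forall>x y. block_code P l m x = block_code P l m y \<longrightarrow> v x = v y)"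

lemma blockwiseD: "blockwise m v \<Longrightarrow> block_code P l m x = block_code P l m y \<Longrightarrow> v x = v y"
  unfolding blockwise_def by blast

lemma sets_Past: "sets Past = sigma_sets UNIV past_events"
  and space_Past: "space Past = UNIV"
  unfolding Past_def by (simp_all add: sets_measure_of space_measure_of)

lemma subalgebra_Past: "subalgebra law Past"
proof -
  have "past_events \<subseteq> sets Seq"
    using measurable_sets[OF measurable_block_code] by (fastforce simp: past_events_def space_Seq)
  then have "sigma_sets (space Seq) past_events \<subseteq> sets Seq"
    by (rule sets.sigma_sets_subset)
  then show ?thesis
    unfolding subalgebra_def by (simp add: space_Past sets_Past space_Seq)
qed

text \<open>A point lies in an open set if and only if its cell does at some level, and this level can be taken so high
  that the block contains the coordinate.\<close>
lemma measurable_coordinate_Past: "(\<lambda>x. x (- int i)) \<in> borel_measurable Past"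
proof (rule borel_measurableI)
  fix U :: "real set" assume U: "open U"
  let ?I = "{m. 1 \<le> m \<and> i < l m}"
  let ?A = "\<lambda>m. {x. cell P m (x (- int i)) \<subseteq> U}"
  have A: "?A m \<in> sets Past" if m: "m \<in> ?I" for m
  proof -
    have "?A m = block_code P l m -` (block_code P l m ` ?A m)"
      using m by (auto simp: block_code_eq_iff)
    then have "?A m \<in> past_events"
      using m unfolding past_events_def by blast
    then show ?thesis by (auto simp: sets_Past intro: sigma_sets.Basic)
  qed
  have "(\<lambda>x. x (- int i)) -` U = (\<Union>m\<in>?I. ?A m)"
  proof (intro equalityI subsetI)
    fix x :: "int \<Rightarrow> real" assume "x \<in> (\<lambda>x. x (- int i)) -` U"
    then obtain e where e: "0 < e" "ball (x (- int i)) e \<subseteq> U"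
      using U unfolding open_contains_ball by auto
    have "(\<lambda>k. ediam (cell P k (x (- int i)))) \<longlonglongrightarrow> 0"
      using P by (simp add: interval_partitions_def)
    then have "\<forall>\<^sub>F m in sequentially. ediam (cell P m (x (- int i))) < ereal e"
      using e(1) by (intro order_tendstoD) auto
    moreover have "\<forall>\<^sub>F m in sequentially. i < l m"
    proof -
      have "filterlim l at_top sequentially" using l by (simp add: block_lengths_def)
      then have "\<forall>\<^sub>F m in sequentially. Suc i \<le> l m" unfolding filterlim_at_top by blast
      then show ?thesis by (simp add: Suc_le_eq)
    qed
    moreover have "\<forall>\<^sub>F m in sequentially. 1 \<le> m" by (rule eventually_ge_at_top)
    ultimately have "\<forall>\<^sub>F m in sequentially. ediam (cell P m (x (- int i))) < ereal e \<and> m \<in> ?I"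
      by eventually_elim simp
    then obtain m where m: "ediam (cell P m (x (- int i))) < ereal e" "m \<in> ?I"
      using eventually_happens'[OF sequentially_bot] by blast
    have "cell P m (x (- int i)) \<subseteq> ball (x (- int i)) e"
    proof
      fix y assume y: "y \<in> cell P m (x (- int i))"
      have "ereal \<bar>y - x (- int i)\<bar> \<le> ediam (cell P m (x (- int i)))"
        unfolding ediam_def
        by (rule SUP_upper2[of "(x (- int i), y)"]) (use y cell(2) in auto)
      also note m(1)
      finally show "y \<in> ball (x (- int i)) e" by (simp add: dist_real_def abs_minus_commute)
    qed
    then have "x \<in> ?A m" using e(2) by blast
    then show "x \<in> (\<Union>m\<in>?I. ?A m)" using m(2) by (intro UN_I[of m])
  next
    fix x assume "x \<in> (\<Union>m\<in>?I. ?A m)"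
    then show "x \<in> (\<lambda>x. x (- int i)) -` U" using cell(2) by blast
  qed
  also have "\<dots> \<in> sets Past"
    using A by (intro sets.countable_UN'') auto
  finally show "(\<lambda>x. x (- int i)) -` U \<inter> space Past \<in> sets Past"
    by (simp add: space_Past)
qed

text \<open>Seen from time \<open>n\<close>, the observations at the times \<open>0, \<dots>, n\<close> belong to the past.\<close>
lemma F_event_eq_past_event:
  assumes "A \<in> sets (F (enat n))"
  obtains B where "B \<in> sets Past" "A = trajectory X (int n) -` B \<inter> space M"
proof -
  let ?V = "vimage_algebra (space M) (trajectory X (int n)) Past"
  have "sets (F (enat n)) \<subseteq> sets ?V"
    unfolding sets_F
  proof (subst space_vimage_algebra[symmetric], rule sets.sigma_sets_subset, clarify)
    fix i and B :: "real set" assume i: "enat i \<le> enat n" and B: "B \<in> sets borel"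
    have "trajectory X (int n) \<omega> (- int (n - i)) = X (int i) \<omega>" for \<omega>
      using i by (simp add: trajectory_def of_nat_diff)
    then have "X (int i) -` B \<inter> space M
        = trajectory X (int n) -` ((\<lambda>x. x (- int (n - i))) -` B \<inter> space Past) \<inter> space M"
      by (auto simp: space_Past)
    moreover have "(\<lambda>x. x (- int (n - i))) -` B \<inter> space Past \<in> sets Past"
      by (rule measurable_sets[OF measurable_coordinate_Past B])
    ultimately show "X (int i) -` B \<inter> space M \<in> sets ?V"
      using in_vimage_algebra by metis
  qed
  with assms have "A \<in> sets ?V" by blast
  then show thesis
    using that by (subst (asm) sets_vimage_algebra2) (auto simp: space_Past)
qed

sublocale law: prob_space law by (rule prob_space_law)

sublocale Past: finite_measure_subalgebra law Past
  by unfold_locales (rule subalgebra_Past)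

lemma future_L2: "(\<lambda>x. x 1) \<in> L2 law"
proof -
  \<comment> \<open>seen from time \<open>- 1\<close>, the coordinate \<open>1\<close> is \<open>X 0\<close>\<close>
  have "integrable (distr M Seq (trajectory X (- 1))) (\<lambda>x. (x 1)\<^sup>2)"
    by (subst integrable_distr_eq) (auto simp: trajectory_def square_integrable intro!: measurable_trajectory)
  then have "integrable law (\<lambda>x. (x 1)\<^sup>2)" by (simp add: distr_trajectory)
  moreover have "(\<lambda>x. x 1) \<in> borel_measurable law"
    by (simp cong: measurable_cong_sets)
  ultimately show ?thesis by (simp add: L2_def)
qed

lemma regression_L2: "regression \<in> L2 law"
  unfolding regression_def by (rule Past.real_cond_exp_L2(1)[OF future_L2])

text \<open>Two functions of blocks of levels \<open>i\<close> and \<open>j\<close> are both functions of the block of level \<open>max i j\<close>.\<close>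
lemma L2_lattice_blockwise: "L2_lattice law {v \<in> L2 law. \<exists>m\<ge>1. blockwise m v}"
proof -
  have combine: "\<exists>m\<ge>1. blockwise m (\<lambda>x. h (v x) (w x))"
    if "1 \<le> i" "blockwise i v" "1 \<le> j" "blockwise j w" for h v w i j
  proof (intro exI conjI)
    show "blockwise (max i j) (\<lambda>x. h (v x) (w x))"
      unfolding blockwise_def
    proof (intro allI impI)
      fix x y assume eq: "block_code P l (max i j) x = block_code P l (max i j) y"
      have "block_code P l i x = block_code P l i y" "block_code P l j x = block_code P l j y"
        using block_code_eq_mono[OF that(1) max.cobounded1 eq] block_code_eq_mono[OF that(3) max.cobounded2 eq] .
      then have "v x = v y" "w x = w y" using that(2,4) unfolding blockwise_def by blast+
      then show "h (v x) (w x) = h (v y) (w y)" by simp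
    qed
  qed (use that in simp)
  show ?thesis
  proof
    show "(\<lambda>_. c) \<in> {v \<in> L2 law. \<exists>m\<ge>1. blockwise m v}" for c
      using law.L2_const by (auto simp: blockwise_def)
    fix v assume v: "v \<in> {v \<in> L2 law. \<exists>m\<ge>1. blockwise m v}"
    show "(\<lambda>x. c * v x) \<in> {v \<in> L2 law. \<exists>m\<ge>1. blockwise m v}" for c
      using v combine[of _ v _ v "\<lambda>a b. c * a"] by (auto intro: L2_cmult)
    fix w assume w: "w \<in> {v \<in> L2 law. \<exists>m\<ge>1. blockwise m v}"
    show "(\<lambda>x. v x + w x) \<in> {v \<in> L2 law. \<exists>m\<ge>1. blockwise m v}"
      using v w combine[of _ v _ w "(+)"] by (auto intro: L2_add)
    show "(\<lambda>x. max (v x) (w x)) \<in> {v \<in> L2 law. \<exists>m\<ge>1. blockwise m v}"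
      using v w combine[of _ v _ w max] by (auto intro: L2_max)
  qed auto
qed

text \<open>The events that generate the past have indicators that are functions of blocks, so the density statement
  applies.\<close>
lemma regression_approximation:
  assumes "0 < e"
  obtains m v where "1 \<le> m" "blockwise m v" "v \<in> L2 law" "(\<integral>x. (regression x - v x)\<^sup>2 \<partial>law) < e"
proof -
  interpret V: L2_lattice law "{v \<in> L2 law. \<exists>m\<ge>1. blockwise m v}"
    by (rule L2_lattice_blockwise)
  have "V.approximable regression"
  proof (rule V.approximable_measurable[OF _ regression_L2])
    fix A assume "A \<in> past_events"
    then obtain m Y where A: "A = block_code P l m -` Y" "1 \<le> m" by (auto simp: past_events_def)
    have "A \<in> sets law"
      using measurable_sets[OF measurable_block_code, of Y] by (simp add: A space_Seq)
    then have "indicator A \<in> L2 law"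
      by (intro L2_bounded_by[OF law.L2_const[of 1]]) (auto simp: indicator_def)
    moreover have "blockwise m (indicator A)"
      by (simp add: blockwise_def A indicator_def)
    ultimately show "A \<subseteq> space law \<and> indicator A \<in> {v \<in> L2 law. \<exists>m\<ge>1. blockwise m v}"
      using A(2) by auto
  next
    show "regression \<in> borel_measurable (sigma (space law) past_events)"
      using borel_measurable_cond_exp[of law Past "\<lambda>x. x 1"] by (simp add: regression_def Past_def)
  qed
  from V.approximableD(2)[OF this assms] show thesis using that by blast
qed

section \<open>Conditional expectations at the stopping times\<close>

text \<open>Invariance of the law, in the form in which it enters the estimates.\<close>
lemma L2_view:
  assumes v: "v \<in> L2 law"
  shows "(\<lambda>\<omega>. v (view k \<omega>)) \<in> L2 M"
    and "(\<integral>\<omega>. (v (view k \<omega>))\<^sup>2 \<partial>M) = (\<integral>x. (v x)\<^sup>2 \<partial>law)"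
proof -
  have d: "distr M Seq (view k) = law" using distr_view by blast
  have [measurable]: "v \<in> borel_measurable Seq"
    using L2D(1)[OF v] by (simp cong: measurable_cong_sets)
  have "integrable (distr M Seq (view k)) (\<lambda>x. (v x)\<^sup>2)"
    unfolding d by (rule L2D(2)[OF v])
  then have "integrable M (\<lambda>\<omega>. (v (view k \<omega>))\<^sup>2)"
    by (subst (asm) integrable_distr_eq) auto
  then show "(\<lambda>\<omega>. v (view k \<omega>)) \<in> L2 M" by (simp add: L2_def)
  have "(\<integral>x. (v x)\<^sup>2 \<partial>distr M Seq (view k)) = (\<integral>\<omega>. (v (view k \<omega>))\<^sup>2 \<partial>M)"
    by (rule integral_distr) auto
  then show "(\<integral>\<omega>. (v (view k \<omega>))\<^sup>2 \<partial>M) = (\<integral>x. (v x)\<^sup>2 \<partial>law)"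
    unfolding d by simp
qed

lemma next_obs_eq_view: "next_obs P l X k = (\<lambda>\<omega>. view k \<omega> 1)"
  by (simp add: next_obs_def view_def trajectory_def fun_eq_iff add.commute)

abbreviation forecast :: "nat \<Rightarrow> 'a \<Rightarrow> real" where
  "forecast k \<equiv> real_cond_exp M (FS k) (next_obs P l X k)"

lemma next_obs_L2: "next_obs P l X k \<in> L2 M"
  and forecast_L2: "forecast k \<in> L2 M"
  and integral_next_obs_square: "(\<integral>\<omega>. (next_obs P l X k \<omega>)\<^sup>2 \<partial>M) = (\<integral>x. (x 1)\<^sup>2 \<partial>law)"
  using L2_view[OF future_L2, of k] FS.real_cond_exp_L2(1)[of _ k]
  unfolding next_obs_eq_view by auto

text \<open>On the part of \<open>A\<close> where \<open>\<zeta> k = n\<close> the recentred series is the trajectory seen from the fixed time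
  \<open>n\<close>, and that part of \<open>A\<close> is an event of its past. There the claim is the definition of the regression,
  transported by stationarity.\<close>
lemma set_integral_residual_eq_0:
  assumes A: "A \<in> sets (FS k)"
  shows "(\<integral>\<omega>\<in>A. (view k \<omega> 1 - regression (view k \<omega>)) \<partial>M) = 0"
proof -
  define u where "u x = x 1 - regression x" for x
  have u: "u \<in> L2 law"
    unfolding u_def by (intro L2_diff future_L2 regression_L2)
  have u_Seq[measurable]: "u \<in> borel_measurable Seq"
    using L2D(1)[OF u] by (simp cong: measurable_cong_sets)
  have int_u: "integrable M (\<lambda>\<omega>. u (view k \<omega>))"
    by (rule L2_integrable[OF L2_view(1)[OF u]])
  have A_M: "A \<in> sets M"
    using A subalgebra_FS by (auto simp: subalgebra_def)
  define An where "An n = {\<omega> \<in> A. \<zeta> k \<omega> = enat n}" for n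
  have An_F: "An n \<in> sets (F (enat n))" for n
  proof -
    have "{\<omega> \<in> A. \<zeta> k \<omega> \<le> enat n} \<inter> {\<omega> \<in> space (F (enat n)). \<zeta> k \<omega> = enat n} \<in> sets (F (enat n))"
      using A predE[OF pred_zeta_eq] unfolding sets_FS by blast
    also have "{\<omega> \<in> A. \<zeta> k \<omega> \<le> enat n} \<inter> {\<omega> \<in> space (F (enat n)). \<zeta> k \<omega> = enat n} = An n"
      using sets.sets_into_space[OF A_M] by (auto simp: An_def obs.space_F)
    finally show ?thesis .
  qed
  have An_M: "An n \<in> sets M" for n using An_F sets_F_subset by blast
  have zero: "(\<integral>\<omega>\<in>An n. u (view k \<omega>) \<partial>M) = 0" for n
  proof -
    obtain B where B: "B \<in> sets Past" "An n = trajectory X (int n) -` B \<inter> space M"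
      by (rule F_event_eq_past_event[OF An_F])
    have B_law: "B \<in> sets law" using B(1) subalgebra_Past by (auto simp: subalgebra_def)
    then have [measurable]: "B \<in> sets Seq" by simp
    note [measurable] = measurable_trajectory[OF measurable_X, where n="int n"]
    have "(\<integral>\<omega>\<in>An n. u (view k \<omega>) \<partial>M) = (\<integral>\<omega>. indicator B (trajectory X (int n) \<omega>) * u (trajectory X (int n) \<omega>) \<partial>M)"
      unfolding set_lebesgue_integral_def
    proof (rule Bochner_Integration.integral_cong)
      fix \<omega> assume "\<omega> \<in> space M"
      then have "indicator (An n) \<omega> = (indicator B (trajectory X (int n) \<omega>) :: real)"
        using B(2) by (auto simp: indicator_def)
      moreover have "view k \<omega> = trajectory X (int n) \<omega>" if "\<omega> \<in> An n"
        using that by (simp add: An_def view_def)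
      ultimately show "indicator (An n) \<omega> *\<^sub>R u (view k \<omega>) = indicator B (trajectory X (int n) \<omega>) * u (trajectory X (int n) \<omega>)"
        by (cases "\<omega> \<in> An n") auto
    qed simp
    also have "\<dots> = (\<integral>x. indicator B x * u x \<partial>distr M Seq (trajectory X (int n)))"
      by (rule integral_distr[symmetric]) auto
    also have "\<dots> = (\<integral>x. indicator B x * u x \<partial>law)"
      by (simp add: distr_trajectory)
    also have "\<dots> = (\<integral>x\<in>B. x 1 \<partial>law) - (\<integral>x\<in>B. regression x \<partial>law)"
    proof -
      have "integrable law (\<lambda>x. indicator B x * x 1)" "integrable law (\<lambda>x. indicator B x * regression x)"
        using integrable_mult_indicator[OF B_law law.L2_integrable[OF future_L2]]
          integrable_mult_indicator[OF B_law law.L2_integrable[OF regression_L2]] by auto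
      then show ?thesis
        by (simp add: u_def set_lebesgue_integral_def right_diff_distrib)
    qed
    also have "(\<integral>x\<in>B. regression x \<partial>law) = (\<integral>x\<in>B. x 1 \<partial>law)"
      unfolding regression_def
      by (rule Past.real_cond_exp_intA[OF law.L2_integrable[OF future_L2] B(1), symmetric])
    finally show ?thesis by simp
  qed
  have "AE \<omega> in M. \<zeta> k \<omega> \<noteq> \<infinity>" using distr_view by blast
  then have "(\<integral>\<omega>\<in>A. u (view k \<omega>) \<partial>M) = (\<integral>\<omega>\<in>(\<Union>n. An n). u (view k \<omega>) \<partial>M)"
    unfolding set_lebesgue_integral_def
  proof (intro integral_cong_AE)
    have [measurable]: "A \<in> sets M" "(\<Union>n. An n) \<in> sets M" using A_M An_M by auto
    show "(\<lambda>\<omega>. indicator A \<omega> *\<^sub>R u (view k \<omega>)) \<in> borel_measurable M"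
      "(\<lambda>\<omega>. indicator (\<Union>n. An n) \<omega> *\<^sub>R u (view k \<omega>)) \<in> borel_measurable M"
      by measurable
    assume "AE \<omega> in M. \<zeta> k \<omega> \<noteq> \<infinity>"
    then show "AE \<omega> in M. indicator A \<omega> *\<^sub>R u (view k \<omega>) = indicator (\<Union>n. An n) \<omega> *\<^sub>R u (view k \<omega>)"
    proof eventually_elim
      case (elim \<omega>)
      then have "\<omega> \<in> A \<longleftrightarrow> \<omega> \<in> (\<Union>n. An n)" by (auto simp: An_def)
      then show ?case by (simp add: indicator_def)
    qed
  qed
  also have "\<dots> = (\<Sum>n. \<integral>\<omega>\<in>An n. u (view k \<omega>) \<partial>M)"
  proof (rule lebesgue_integral_countable_add[OF An_M])
    show "set_integrable M (\<Union>n. An n) (\<lambda>\<omega>. u (view k \<omega>))"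
      unfolding set_integrable_def using An_M by (intro integrable_mult_indicator int_u) auto
  qed (auto simp: An_def)
  also have "\<dots> = 0" by (simp add: zero)
  finally show ?thesis by (simp add: u_def)
qed

text \<open>The information at \<open>\<zeta> k\<close> is only a part of the past of the recentred series, since the observations
  start at time \<open>0\<close>. The forecast therefore need not be the regression itself, but conditioning the
  regression once more gives it.\<close>
lemma forecast_eq: "AE \<omega> in M. forecast k \<omega> = real_cond_exp M (FS k) (\<lambda>\<omega>. regression (view k \<omega>)) \<omega>"
proof -
  note int = L2_integrable[OF L2_view(1)[OF future_L2], of k] L2_integrable[OF L2_view(1)[OF regression_L2], of k]
  have "AE \<omega> in M. real_cond_exp M (FS k) (\<lambda>\<omega>. view k \<omega> 1 - regression (view k \<omega>)) \<omega> = 0"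
    by (rule FS.real_cond_exp_charact) (use int in \<open>auto simp: set_integral_residual_eq_0\<close>)
  with FS.real_cond_exp_diff[OF int, of k] show ?thesis
    unfolding next_obs_eq_view by eventually_elim simp
qed

text \<open>The function \<open>v\<close> of the block of level \<open>m\<close> is known at \<open>\<zeta> k\<close>, so the difference is the conditional
  expectation of \<open>regression - v\<close> at \<open>view k\<close>. That \<open>v\<close> may be evaluated at \<open>view m\<close> instead is what
  makes one random variable serve for all \<open>k \<ge> m\<close>.\<close>
lemma forecast_error_le:
  assumes m: "1 \<le> m" "m \<le> k" and v: "blockwise m v" "v \<in> L2 law"
  shows "(\<integral>\<omega>. (forecast k \<omega> - v (view m \<omega>))\<^sup>2 \<partial>M) \<le> (\<integral>x. (regression x - v x)\<^sup>2 \<partial>law)"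
proof -
  define w where "w \<omega> = (if \<zeta> k \<omega> = \<infinity> then 0 else v (view k \<omega>))" for \<omega>
  have fin: "AE \<omega> in M. \<zeta> k \<omega> \<noteq> \<infinity>" using distr_view by blast
  have w_FS: "w \<in> borel_measurable (FS k)"
    unfolding w_def by (rule measurable_block_function[OF blockwiseD[OF v(1)] m])
  have w_view: "AE \<omega> in M. w \<omega> = v (view k \<omega>)"
    using fin by eventually_elim (simp add: w_def del: not_infinity_eq)
  have w_L2: "w \<in> L2 M"
    by (rule L2_AE_cong[OF L2_view(1)[OF v(2)] measurable_from_subalg[OF subalgebra_FS w_FS] w_view])
  have stable: "AE \<omega> in M. v (view m \<omega>) = w \<omega>"
    using fin
  proof eventually_elim
    case (elim \<omega>)
    have "v (view k \<omega>) = v (view m \<omega>)"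
      by (rule blockwiseD[OF v(1) block_code_view_stable[OF m elim]])
    with elim show ?case by (simp add: w_def del: not_infinity_eq)
  qed
  define d where "d \<omega> = regression (view k \<omega>) - w \<omega>" for \<omega>
  have r_L2: "(\<lambda>\<omega>. regression (view k \<omega>)) \<in> L2 M" by (rule L2_view(1)[OF regression_L2])
  have d_L2: "d \<in> L2 M" unfolding d_def by (rule L2_diff[OF r_L2 w_L2])
  have "AE \<omega> in M. forecast k \<omega> - v (view m \<omega>) = real_cond_exp M (FS k) d \<omega>"
    using forecast_eq[of k] stable FS.real_cond_exp_F_meas[OF L2_integrable[OF w_L2] w_FS]
      FS.real_cond_exp_diff[OF L2_integrable[OF r_L2] L2_integrable[OF w_L2], of k]
    unfolding d_def by eventually_elim simp
  then have "(\<integral>\<omega>. (forecast k \<omega> - v (view m \<omega>))\<^sup>2 \<partial>M) = (\<integral>\<omega>. (real_cond_exp M (FS k) d \<omega>)\<^sup>2 \<partial>M)"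
    using L2D(1)[OF L2_view(1)[OF v(2)]] by (intro integral_cong_AE) auto
  also have "\<dots> \<le> (\<integral>\<omega>. (d \<omega>)\<^sup>2 \<partial>M)"
    by (rule FS.real_cond_exp_L2(2)[OF d_L2])
  also have "\<dots> = (\<integral>\<omega>. (regression (view k \<omega>) - v (view k \<omega>))\<^sup>2 \<partial>M)"
  proof (rule integral_cong_AE)
    show "(\<lambda>\<omega>. (d \<omega>)\<^sup>2) \<in> borel_measurable M" using L2D(1)[OF d_L2] by simp
    show "(\<lambda>\<omega>. (regression (view k \<omega>) - v (view k \<omega>))\<^sup>2) \<in> borel_measurable M"
      using L2D(1)[OF r_L2] L2D(1)[OF L2_view(1)[OF v(2), of k]] by simp
    show "AE \<omega> in M. (d \<omega>)\<^sup>2 = (regression (view k \<omega>) - v (view k \<omega>))\<^sup>2"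
      using w_view by eventually_elim (simp add: d_def)
  qed
  also have "\<dots> = (\<integral>x. (regression x - v x)\<^sup>2 \<partial>law)"
    by (rule L2_view(2)[OF L2_diff[OF regression_L2 v(2)]])
  finally show ?thesis .
qed

section \<open>The estimator\<close>

lemma zeta_mono: "i \<le> j \<Longrightarrow> \<zeta> i \<omega> \<le> \<zeta> j \<omega>"
  by (rule lift_Suc_mono_le[of "\<lambda>k. \<zeta> k \<omega>"]) simp_all

lemma sets_FS_mono: "i \<le> j \<Longrightarrow> sets (FS i) \<subseteq> sets (FS j)"
  unfolding stopped_algebra_def
  by (intro obs.mono_pre_sigma stopping_time_zeta zeta_mono)

definition innovation :: "nat \<Rightarrow> 'a \<Rightarrow> real" where
  "innovation j \<omega> = next_obs P l X j \<omega> - forecast j \<omega>"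

lemma innovation_L2: "innovation j \<in> L2 M"
  unfolding innovation_def by (intro L2_diff next_obs_L2 forecast_L2)

text \<open>The earlier innovation is known at \<open>\<zeta> j\<close>, and given what is known there the later one has
  conditional expectation zero.\<close>
lemma innovations_orthogonal:
  assumes "i < j"
  shows "(\<integral>\<omega>. innovation i \<omega> * innovation j \<omega> \<partial>M) = 0"
proof -
  have "subalgebra (FS j) (FS i)"
    using sets_FS_mono[of i j] assms by (simp add: subalgebra_def stopped_algebra_def obs.space_pre_sigma)
  from measurable_from_subalg[OF this borel_measurable_cond_exp]
  have "innovation i \<in> borel_measurable (FS j)"
    unfolding innovation_def using measurable_next_obs[OF assms] by measurable
  then have "(\<integral>\<omega>. innovation i \<omega> * forecast j \<omega> \<partial>M) = (\<integral>\<omega>. innovation i \<omega> * next_obs P l X j \<omega> \<partial>M)"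
    using L2_mult[OF innovation_L2 next_obs_L2] L2D(1)[OF next_obs_L2] by (intro FS.real_cond_exp_intg(2))
  then show ?thesis
    using L2_mult[OF innovation_L2 next_obs_L2] L2_mult[OF innovation_L2 forecast_L2]
    unfolding innovation_def[of j] by (simp add: right_diff_distrib)
qed

lemma integral_innovation_square_le: "(\<integral>\<omega>. (innovation j \<omega>)\<^sup>2 \<partial>M) \<le> 4 * (\<integral>x. (x 1)\<^sup>2 \<partial>law)"
proof -
  have "(\<integral>\<omega>. (innovation j \<omega>)\<^sup>2 \<partial>M) = (\<integral>\<omega>. (next_obs P l X j \<omega> + - 1 * forecast j \<omega>)\<^sup>2 \<partial>M)"
    by (simp add: innovation_def)
  also have "\<dots> \<le> 2 * (\<integral>\<omega>. (next_obs P l X j \<omega>)\<^sup>2 \<partial>M) + 2 * (\<integral>\<omega>. (- 1 * forecast j \<omega>)\<^sup>2 \<partial>M)"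
    by (intro integral_square_add_le L2_cmult next_obs_L2 forecast_L2)
  also have "(\<integral>\<omega>. (- 1 * forecast j \<omega>)\<^sup>2 \<partial>M) \<le> (\<integral>\<omega>. (next_obs P l X j \<omega>)\<^sup>2 \<partial>M)"
    using FS.real_cond_exp_L2(2)[OF next_obs_L2] by simp
  finally show ?thesis by (simp add: integral_next_obs_square)
qed

lemma average_innovation_le:
  assumes "0 < k"
  shows "(\<integral>\<omega>. (1 / real k * (\<Sum>j<k. innovation j \<omega>))\<^sup>2 \<partial>M) \<le> 4 * (\<integral>x. (x 1)\<^sup>2 \<partial>law) / real k"
proof -
  have "(\<integral>\<omega>. (1 / real k * (\<Sum>j<k. innovation j \<omega>))\<^sup>2 \<partial>M) = (1 / real k)\<^sup>2 * (\<integral>\<omega>. (\<Sum>j<k. innovation j \<omega>)\<^sup>2 \<partial>M)"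
    unfolding power_mult_distrib by simp
  also have "(\<integral>\<omega>. (\<Sum>j<k. innovation j \<omega>)\<^sup>2 \<partial>M) = (\<Sum>j<k. \<integral>\<omega>. (innovation j \<omega>)\<^sup>2 \<partial>M)"
    by (intro integral_square_sum_orthogonal innovation_L2 innovations_orthogonal)
  also have "\<dots> \<le> (\<Sum>j<k. 4 * (\<integral>x. (x 1)\<^sup>2 \<partial>law))"
    by (intro sum_mono integral_innovation_square_le)
  also have "(1 / real k)\<^sup>2 * \<dots> = 4 * (\<integral>x. (x 1)\<^sup>2 \<partial>law) / real k"
    using assms by (simp add: power2_eq_square)
  finally show ?thesis by (simp add: mult_left_mono)
qed

lemma average_square_le:
  assumes "\<And>j. f j \<in> L2 M" "0 < k"
  shows "(\<integral>\<omega>. (1 / real k * (\<Sum>j<k. f j \<omega>))\<^sup>2 \<partial>M) \<le> 1 / real k * (\<Sum>j<k. \<integral>\<omega>. (f j \<omega>)\<^sup>2 \<partial>M)"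
proof -
  have "(\<integral>\<omega>. (1 / real k * (\<Sum>j<k. f j \<omega>))\<^sup>2 \<partial>M) \<le> (\<integral>\<omega>. 1 / real k * (\<Sum>j<k. (f j \<omega>)\<^sup>2) \<partial>M)"
  proof (rule integral_mono)
    show "integrable M (\<lambda>\<omega>. (1 / real k * (\<Sum>j<k. f j \<omega>))\<^sup>2)"
      using assms(1) by (intro L2D(2) L2_cmult L2_sum)
    show "integrable M (\<lambda>\<omega>. 1 / real k * (\<Sum>j<k. (f j \<omega>)\<^sup>2))"
      using L2D(2)[OF assms(1)] by auto
    fix \<omega>
    have "(1 / real k)\<^sup>2 * (\<Sum>j<k. f j \<omega>)\<^sup>2 \<le> (1 / real k)\<^sup>2 * ((\<Sum>j<k. (f j \<omega>)\<^sup>2) * real k)"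
      using sum_squared_le_sum_of_squares[of "\<lambda>j. f j \<omega>" "{..<k}"] by (intro mult_left_mono) auto
    also have "\<dots> = 1 / real k * (\<Sum>j<k. (f j \<omega>)\<^sup>2)"
      using assms(2) by (simp add: power2_eq_square)
    finally show "(1 / real k * (\<Sum>j<k. f j \<omega>))\<^sup>2 \<le> 1 / real k * (\<Sum>j<k. (f j \<omega>)\<^sup>2)"
      by (simp only: power_mult_distrib)
  qed
  also have "\<dots> = 1 / real k * (\<Sum>j<k. \<integral>\<omega>. (f j \<omega>)\<^sup>2 \<partial>M)"
    using L2D(2)[OF assms(1)] by simp
  finally show ?thesis .
qed

lemma estimator_L2: "estimator P l X k \<in> L2 M"
  unfolding estimator_def by (intro L2_cmult L2_sum next_obs_L2)

text \<open>With \<open>w = v \<circ> view m\<close>, the error is the sum of the average of the innovations, the average of the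
  differences \<open>forecast j - w\<close>, and \<open>w - forecast k\<close>. In the second average the first \<open>m\<close> terms are
  damped by \<open>1 / k\<close> and the others are at most \<open>\<delta>\<close>.\<close>
proposition estimator_error_le:
  assumes m: "1 \<le> m" "m \<le> k" and v: "blockwise m v" "v \<in> L2 law"
    and \<delta>: "(\<integral>x. (regression x - v x)\<^sup>2 \<partial>law) \<le> \<delta>"
  shows "(\<integral>\<omega>. (estimator P l X k \<omega> - forecast k \<omega>)\<^sup>2 \<partial>M) \<le>
    (8 * (\<integral>x. (x 1)\<^sup>2 \<partial>law) + 4 * (\<Sum>j<m. \<integral>\<omega>. (forecast j \<omega> - v (view m \<omega>))\<^sup>2 \<partial>M)) / real k + 8 * \<delta>"
proof -
  let ?S = "\<integral>x. (x 1)\<^sup>2 \<partial>law"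
  define w where "w \<omega> = v (view m \<omega>)" for \<omega>
  define K where "K = (\<Sum>j<m. \<integral>\<omega>. (forecast j \<omega> - w \<omega>)\<^sup>2 \<partial>M)"
  define a where "a \<omega> = 1 / real k * (\<Sum>j<k. innovation j \<omega>)" for \<omega>
  define b where "b \<omega> = 1 / real k * (\<Sum>j<k. forecast j \<omega> - w \<omega>)" for \<omega>
  define c where "c \<omega> = - 1 * (forecast k \<omega> - w \<omega>)" for \<omega>
  have k: "0 < k" using m by simp
  have w: "w \<in> L2 M" unfolding w_def by (rule L2_view(1)[OF v(2)])
  have fw: "(\<lambda>\<omega>. forecast j \<omega> - w \<omega>) \<in> L2 M" for j
    by (intro L2_diff forecast_L2 w)
  have a: "a \<in> L2 M" unfolding a_def by (intro L2_cmult L2_sum innovation_L2)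
  have b: "b \<in> L2 M" unfolding b_def by (intro L2_cmult L2_sum fw)
  have c: "c \<in> L2 M" unfolding c_def by (intro L2_cmult fw)
  have late: "(\<integral>\<omega>. (forecast j \<omega> - w \<omega>)\<^sup>2 \<partial>M) \<le> \<delta>" if "m \<le> j" for j
    unfolding w_def using forecast_error_le[OF m(1) that v] \<delta> by linarith
  have 1: "estimator P l X k \<omega> - forecast k \<omega> = a \<omega> + (b \<omega> + c \<omega>)" for \<omega>
  proof -
    have "real k * w \<omega> / real k = w \<omega>" using k by simp
    then show ?thesis
      by (simp add: estimator_def a_def b_def c_def innovation_def sum_subtractf diff_divide_distrib
          atLeast0LessThan)
  qed
  have "(\<integral>\<omega>. (estimator P l X k \<omega> - forecast k \<omega>)\<^sup>2 \<partial>M)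
      \<le> 2 * (\<integral>\<omega>. (a \<omega>)\<^sup>2 \<partial>M) + 2 * (\<integral>\<omega>. (b \<omega> + c \<omega>)\<^sup>2 \<partial>M)"
    unfolding 1 by (intro integral_square_add_le L2_add a b c)
  also have "(\<integral>\<omega>. (b \<omega> + c \<omega>)\<^sup>2 \<partial>M) \<le> 2 * (\<integral>\<omega>. (b \<omega>)\<^sup>2 \<partial>M) + 2 * (\<integral>\<omega>. (c \<omega>)\<^sup>2 \<partial>M)"
    by (intro integral_square_add_le b c)
  also have "(\<integral>\<omega>. (c \<omega>)\<^sup>2 \<partial>M) \<le> \<delta>"
    using late[OF m(2)] by (simp add: c_def power2_commute)
  also have "(\<integral>\<omega>. (b \<omega>)\<^sup>2 \<partial>M) \<le> K / real k + \<delta>"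
  proof -
    have "(\<integral>\<omega>. (b \<omega>)\<^sup>2 \<partial>M) \<le> 1 / real k * (\<Sum>j<k. \<integral>\<omega>. (forecast j \<omega> - w \<omega>)\<^sup>2 \<partial>M)"
      unfolding b_def by (rule average_square_le[OF fw k])
    also have "(\<Sum>j<k. \<integral>\<omega>. (forecast j \<omega> - w \<omega>)\<^sup>2 \<partial>M)
        = K + (\<Sum>j\<in>{m..<k}. \<integral>\<omega>. (forecast j \<omega> - w \<omega>)\<^sup>2 \<partial>M)"
      unfolding K_def using m(2) by (simp add: lessThan_atLeast0 sum.atLeastLessThan_concat)
    also have "\<dots> \<le> K + real (k - m) * \<delta>"
      using sum_bounded_above[of "{m..<k}" "\<lambda>j. \<integral>\<omega>. (forecast j \<omega> - w \<omega>)\<^sup>2 \<partial>M" \<delta>] late by simp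
    also have "\<dots> \<le> K + real k * \<delta>"
    proof -
      have "0 \<le> (\<integral>\<omega>. (forecast m \<omega> - w \<omega>)\<^sup>2 \<partial>M)" by simp
      also have "\<dots> \<le> \<delta>" by (rule late[OF order_refl])
      finally show ?thesis by (intro add_left_mono mult_right_mono) auto
    qed
    finally show ?thesis using k by (simp add: field_simps mult_left_mono)
  qed
  also have "(\<integral>\<omega>. (a \<omega>)\<^sup>2 \<partial>M) \<le> 4 * ?S / real k"
    unfolding a_def by (rule average_innovation_le[OF k])
  finally show ?thesis
    unfolding K_def w_def by (simp add: add_divide_distrib algebra_simps)
qed

theorem estimator_consistent:
  "(\<lambda>k. \<integral>\<omega>. (estimator P l X k \<omega> - forecast k \<omega>)\<^sup>2 \<partial>M) \<longlonglongrightarrow> 0"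
proof (rule order_tendstoI)
  fix e :: real assume "0 < e"
  \<comment> \<open>the bound for the estimator contains \<open>8 * \<delta>\<close>, so \<open>\<delta> = e / 16\<close> leaves \<open>e / 2\<close> for the rest\<close>
  then obtain m v where v: "1 \<le> m" "blockwise m v" "v \<in> L2 law" "(\<integral>x. (regression x - v x)\<^sup>2 \<partial>law) < e / 16"
    using regression_approximation[of "e / 16"] by auto
  define C where "C = 8 * (\<integral>x. (x 1)\<^sup>2 \<partial>law) + 4 * (\<Sum>j<m. \<integral>\<omega>. (forecast j \<omega> - v (view m \<omega>))\<^sup>2 \<partial>M)"
  have "(\<lambda>k. C / real k) \<longlonglongrightarrow> 0" by (rule lim_const_over_n)
  then have "\<forall>\<^sub>F k in sequentially. C / real k < e / 2"
    using \<open>0 < e\<close> by (intro order_tendstoD) auto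
  then show "\<forall>\<^sub>F k in sequentially. (\<integral>\<omega>. (estimator P l X k \<omega> - forecast k \<omega>)\<^sup>2 \<partial>M) < e"
    using eventually_ge_at_top[of m]
  proof eventually_elim
    case (elim k)
    then show ?case
      using estimator_error_le[OF v(1) elim(2) v(2,3) less_imp_le[OF v(4)]] unfolding C_def by linarith
  qed
next
  fix e :: real assume "e < 0"
  then show "\<forall>\<^sub>F k in sequentially. e < (\<integral>\<omega>. (estimator P l X k \<omega> - forecast k \<omega>)\<^sup>2 \<partial>M)"
    by (intro always_eventually allI less_le_trans[OF _ integral_nonneg_AE]) auto
qed

end

theorem theorem2:
  fixes M :: "'a measure" and X :: "int \<Rightarrow> 'a \<Rightarrow> real"
    and P :: "nat \<Rightarrow> real set set" and l :: "nat \<Rightarrow> nat"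
  assumes "prob_space M"
    and "stationary M X"
    and "integrable M (\<lambda>\<omega>. \<bar>X 0 \<omega>\<bar>\<^sup>2)"
    and "interval_partitions P"
    and "block_lengths l"
  shows "(\<lambda>k. \<integral>\<^sup>+\<omega>. ennreal (\<bar>estimator P l X k \<omega>
             - real_cond_exp M (stopped_algebra M P l X k) (next_obs P l X k) \<omega>\<bar>\<^sup>2) \<partial>M)
           \<longlonglongrightarrow> 0"
proof -
  interpret prob_space M by fact
  interpret intermittent_scheme M X P l
    by unfold_locales (use assms in simp_all)
  have "(\<integral>\<^sup>+\<omega>. ennreal (\<bar>estimator P l X k \<omega> - forecast k \<omega>\<bar>\<^sup>2) \<partial>M)
      = ennreal (\<integral>\<omega>. (estimator P l X k \<omega> - forecast k \<omega>)\<^sup>2 \<partial>M)" for k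
    using L2D(2)[OF L2_diff[OF estimator_L2 forecast_L2]] by (simp add: nn_integral_eq_integral)
  then show ?thesis
    using tendsto_ennrealI[OF estimator_consistent] by simp
qed

end
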